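(* Let $n \geq 2$ and let $L_1, L_2 \subset \mathbb{R}^n$ be arbitrary lattices. Suppose that the group $\Gamma(L_1,L_2) \leq G$ is discrete. Then $\Gamma(L_1,L_2)$ is not the free inner product of $\Gamma_{\mathrm{upp}}(L_1)$ and $\Gamma_{\mathrm{low}}(L_2)$, i.e. the canonical homomorphism from the abstract free product $\Gamma_{\mathrm{upp}}(L_1) * \Gamma_{\mathrm{low}}(L_2)$ to $\Gamma(L_1,L_2)$ is not an isomorphism.
   Context: Lattices have full rank. $G = \mathrm{PSL}_2(\mathbb{R}^n) \cong \mathrm{PSL}_2(\mathbb{R})^n$, where $\mathbb{R}^n$ is a ring with componentwise operations, with its Lie group topology. For $x \in \mathbb{R}^n$ let $T^x = \begin{pmatrix}1 & x\\ 0 & 1\end{pmatrix}$, $V^x = \begin{pmatrix}1 & 0\\ x & 1\end{pmatrix} \in G$ (with $0=(0,\dots,0)$, $1=(1,\dots,1)$); in terms of $\mathrm{PSL}_2(\mathbb{R})^n$, the $j$-th components are the corresponding matrices with entry $x_j$. For lattices $L,L_1,L_2 \subset \mathbb{R}^n$: $\Gamma_{\mathrm{upp}}(L) = \{T^x : x \in L\}$, $\Gamma_{\mathrm{low}}(L) = \{V^y : y \in L\}$, and $\Gamma(L_1,L_2) \leq G$ is the subgroup generated by $\Gamma_{\mathrm{upp}}(L_1) \cup \Gamma_{\mathrm{low}}(L_2)$. *)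

theory Defs
  imports "HOL-Analysis.Analysis" "HOL-Algebra.Product_Groups"
begin

section \<open>Free products of groups\<close>

definition fp_words :: "('a, 'm) monoid_scheme \<Rightarrow> ('b, 'k) monoid_scheme \<Rightarrow> ('a + 'b) list set" where
  "fp_words A B = lists (carrier A <+> carrier B)"

text \<open>The least congruence on the monoid of words that makes both inclusions into homomorphisms.\<close>

inductive fp_eq ::
    "('a, 'm) monoid_scheme \<Rightarrow> ('b, 'k) monoid_scheme \<Rightarrow> ('a + 'b) list \<Rightarrow> ('a + 'b) list \<Rightarrow> bool"
  for A :: "('a, 'm) monoid_scheme" and B :: "('b, 'k) monoid_scheme"
where
  fp_refl: "w \<in> fp_words A B \<Longrightarrow> fp_eq A B w w"
| fp_sym: "fp_eq A B u v \<Longrightarrow> fp_eq A B v u"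
| fp_trans: "fp_eq A B u v \<Longrightarrow> fp_eq A B v w \<Longrightarrow> fp_eq A B u w"
| fp_append: "fp_eq A B u u' \<Longrightarrow> fp_eq A B v v' \<Longrightarrow> fp_eq A B (u @ v) (u' @ v')"
| fp_Inl_one: "fp_eq A B [Inl \<one>\<^bsub>A\<^esub>] []"
| fp_Inr_one: "fp_eq A B [Inr \<one>\<^bsub>B\<^esub>] []"
| fp_Inl_mult: "a \<in> carrier A \<Longrightarrow> a' \<in> carrier A \<Longrightarrow> fp_eq A B [Inl a, Inl a'] [Inl (a \<otimes>\<^bsub>A\<^esub> a')]"
| fp_Inr_mult: "b \<in> carrier B \<Longrightarrow> b' \<in> carrier B \<Longrightarrow> fp_eq A B [Inr b, Inr b'] [Inr (b \<otimes>\<^bsub>B\<^esub> b')]"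

definition fp_rel ::
    "('a, 'm) monoid_scheme \<Rightarrow> ('b, 'k) monoid_scheme \<Rightarrow> (('a + 'b) list \<times> ('a + 'b) list) set" where
  "fp_rel A B = {(u, v). fp_eq A B u v}"

definition free_product ::
    "('a, 'm) monoid_scheme \<Rightarrow> ('b, 'k) monoid_scheme \<Rightarrow> ('a + 'b) list set monoid" where
  "free_product A B =
     \<lparr>carrier = fp_words A B // fp_rel A B,
      monoid.mult = (\<lambda>X Y. \<Union>u\<in>X. \<Union>v\<in>Y. fp_rel A B `` {u @ v}),
      one = fp_rel A B `` {[]}\<rparr>"

definition free_product_inl ::
    "('a, 'm) monoid_scheme \<Rightarrow> ('b, 'k) monoid_scheme \<Rightarrow> 'a \<Rightarrow> ('a + 'b) list set" where
  "free_product_inl A B a = fp_rel A B `` {[Inl a]}"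

definition free_product_inr ::
    "('a, 'm) monoid_scheme \<Rightarrow> ('b, 'k) monoid_scheme \<Rightarrow> 'b \<Rightarrow> ('a + 'b) list set" where
  "free_product_inr A B b = fp_rel A B `` {[Inr b]}"

definition fp_eval :: "('c, 'l) monoid_scheme \<Rightarrow> ('a \<Rightarrow> 'c) \<Rightarrow> ('b \<Rightarrow> 'c) \<Rightarrow> ('a + 'b) list \<Rightarrow> 'c" where
  "fp_eval H f g w = foldr (\<lambda>s y. case_sum f g s \<otimes>\<^bsub>H\<^esub> y) w \<one>\<^bsub>H\<^esub>"

text \<open>
  The homomorphism out of the free product induced by homomorphisms \<open>f\<close> and \<open>g\<close> into \<open>H\<close>:
  all words in a class have the same value in \<open>H\<close>, see \<open>free_product_lift_class\<close> below.
\<close>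

definition free_product_lift ::
    "('c, 'l) monoid_scheme \<Rightarrow> ('a \<Rightarrow> 'c) \<Rightarrow> ('b \<Rightarrow> 'c) \<Rightarrow> ('a + 'b) list set \<Rightarrow> 'c" where
  "free_product_lift H f g X = the_elem (fp_eval H f g ` X)"


subsection \<open>The universal property\<close>

lemma fp_words_Nil [simp]: "[] \<in> fp_words A B"
  and fp_words_append [simp]: "u @ v \<in> fp_words A B \<longleftrightarrow> u \<in> fp_words A B \<and> v \<in> fp_words A B"
  and fp_words_Cons_Inl [simp]: "Inl a # w \<in> fp_words A B \<longleftrightarrow> a \<in> carrier A \<and> w \<in> fp_words A B"
  and fp_words_Cons_Inr [simp]: "Inr b # w \<in> fp_words A B \<longleftrightarrow> b \<in> carrier B \<and> w \<in> fp_words A B"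
  by (auto simp: fp_words_def)

lemma fp_words_induct [consumes 1, case_names Nil Inl Inr]:
  assumes "w \<in> fp_words A B"
    and "P []"
    and "\<And>a w. a \<in> carrier A \<Longrightarrow> w \<in> fp_words A B \<Longrightarrow> P w \<Longrightarrow> P (Inl a # w)"
    and "\<And>b w. b \<in> carrier B \<Longrightarrow> w \<in> fp_words A B \<Longrightarrow> P w \<Longrightarrow> P (Inr b # w)"
  shows "P w"
  using assms(1)
proof (induction w)
  case (Cons s w)
  then show ?case using assms(3,4) by (cases s) auto
qed (simp add: assms(2))

locale two_groups = A: group A + B: group B
  for A :: "('a, 'm) monoid_scheme" and B :: "('b, 'k) monoid_scheme"
begin

lemma fp_eq_words: "fp_eq A B u v \<Longrightarrow> u \<in> fp_words A B \<and> v \<in> fp_words A B"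
  by (induction rule: fp_eq.induct) auto

lemma equiv_fp_rel: "equiv (fp_words A B) (fp_rel A B)"
  by (rule equivI)
     (auto simp: fp_rel_def refl_on_def sym_def trans_def
           intro: fp_eq.intros(1-3) dest: fp_eq_words)

lemma fp_class_eq_iff:
  "u \<in> fp_words A B \<Longrightarrow> v \<in> fp_words A B \<Longrightarrow>
     fp_rel A B `` {u} = fp_rel A B `` {v} \<longleftrightarrow> fp_eq A B u v"
  by (subst eq_equiv_class_iff[OF equiv_fp_rel]) (simp_all add: fp_rel_def)

lemma carrier_free_productI [simp]:
  "u \<in> fp_words A B \<Longrightarrow> fp_rel A B `` {u} \<in> carrier (free_product A B)"
  by (simp add: free_product_def quotientI)

lemma carrier_free_productE:
  assumes "X \<in> carrier (free_product A B)"
  obtains u where "u \<in> fp_words A B" "X = fp_rel A B `` {u}"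
  using assms by (auto simp: free_product_def elim!: quotientE)

lemma free_product_one: "\<one>\<^bsub>free_product A B\<^esub> = fp_rel A B `` {[]}"
  by (simp add: free_product_def)

lemma free_product_mult:
  assumes "u \<in> fp_words A B" "v \<in> fp_words A B"
  shows "fp_rel A B `` {u} \<otimes>\<^bsub>free_product A B\<^esub> fp_rel A B `` {v} = fp_rel A B `` {u @ v}"
proof -
  have eq: "fp_rel A B `` {u' @ v'} = fp_rel A B `` {u @ v}"
    if "u' \<in> fp_rel A B `` {u}" "v' \<in> fp_rel A B `` {v}" for u' v'
  proof -
    from that have "fp_eq A B (u @ v) (u' @ v')"
      by (simp add: fp_rel_def fp_append)
    then show ?thesis
      using equiv_class_eq[OF equiv_fp_rel, of "u @ v" "u' @ v'"] by (simp add: fp_rel_def)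
  qed
  have "u \<in> fp_rel A B `` {u}" "v \<in> fp_rel A B `` {v}"
    using assms by (simp_all add: fp_rel_def fp_refl)
  then have "(\<Union>u'\<in>fp_rel A B `` {u}. \<Union>v'\<in>fp_rel A B `` {v}. fp_rel A B `` {u' @ v'}) =
      fp_rel A B `` {u @ v}"
    using eq by blast
  then show ?thesis by (simp add: free_product_def)
qed

lemma fp_left_inverse: "w \<in> fp_words A B \<Longrightarrow> \<exists>v\<in>fp_words A B. fp_eq A B (v @ w) []"
proof (induction rule: fp_words_induct)
  case Nil
  show ?case by (intro bexI[of _ "[]"]) (auto intro: fp_refl)
next
  case (Inl a w)
  then obtain v where v: "v \<in> fp_words A B" "fp_eq A B (v @ w) []" by blast
  have "fp_eq A B [Inl (inv\<^bsub>A\<^esub> a), Inl a] []"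
    using fp_Inl_mult[of "inv\<^bsub>A\<^esub> a" A a B] fp_Inl_one[of A B] Inl(1)
    by (auto intro: fp_trans)
  then have "fp_eq A B (v @ [Inl (inv\<^bsub>A\<^esub> a), Inl a] @ w) (v @ [] @ w)"
    by (intro fp_append fp_refl v(1) Inl(2))
  then show ?case
    using v Inl(1) by (intro bexI[of _ "v @ [Inl (inv\<^bsub>A\<^esub> a)]"]) (auto intro: fp_trans)
next
  case (Inr b w)
  then obtain v where v: "v \<in> fp_words A B" "fp_eq A B (v @ w) []" by blast
  have "fp_eq A B [Inr (inv\<^bsub>B\<^esub> b), Inr b] []"
    using fp_Inr_mult[of "inv\<^bsub>B\<^esub> b" B b A] fp_Inr_one[of A B] Inr(1)
    by (auto intro: fp_trans)
  then have "fp_eq A B (v @ [Inr (inv\<^bsub>B\<^esub> b), Inr b] @ w) (v @ [] @ w)"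
    by (intro fp_append fp_refl v(1) Inr(2))
  then show ?case
    using v Inr(1) by (intro bexI[of _ "v @ [Inr (inv\<^bsub>B\<^esub> b)]"]) (auto intro: fp_trans)
qed

lemma group_free_product: "group (free_product A B)"
proof (rule groupI)
  show "\<one>\<^bsub>free_product A B\<^esub> \<in> carrier (free_product A B)"
    by (simp add: free_product_one)
next
  fix X Y assume "X \<in> carrier (free_product A B)" "Y \<in> carrier (free_product A B)"
  then show "X \<otimes>\<^bsub>free_product A B\<^esub> Y \<in> carrier (free_product A B)"
    by (elim carrier_free_productE) (simp add: free_product_mult)
next
  fix X Y Z
  assume "X \<in> carrier (free_product A B)" "Y \<in> carrier (free_product A B)"
    "Z \<in> carrier (free_product A B)"
  then show "X \<otimes>\<^bsub>free_product A B\<^esub> Y \<otimes>\<^bsub>free_product A B\<^esub> Z =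
      X \<otimes>\<^bsub>free_product A B\<^esub> (Y \<otimes>\<^bsub>free_product A B\<^esub> Z)"
    by (elim carrier_free_productE) (simp add: free_product_mult)
next
  fix X assume "X \<in> carrier (free_product A B)"
  then show "\<one>\<^bsub>free_product A B\<^esub> \<otimes>\<^bsub>free_product A B\<^esub> X = X"
    by (elim carrier_free_productE) (simp add: free_product_one free_product_mult)
next
  fix X assume "X \<in> carrier (free_product A B)"
  then obtain u where u: "u \<in> fp_words A B" "X = fp_rel A B `` {u}"
    by (rule carrier_free_productE)
  obtain v where v: "v \<in> fp_words A B" "fp_eq A B (v @ u) []"
    using fp_left_inverse[OF u(1)] by blast
  have "fp_rel A B `` {v} \<otimes>\<^bsub>free_product A B\<^esub> X = \<one>\<^bsub>free_product A B\<^esub>"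
    unfolding u(2) free_product_one free_product_mult[OF v(1) u(1)]
    using u(1) v by (subst fp_class_eq_iff) simp_all
  with v(1) show "\<exists>Y\<in>carrier (free_product A B). Y \<otimes>\<^bsub>free_product A B\<^esub> X = \<one>\<^bsub>free_product A B\<^esub>"
    by (intro bexI[of _ "fp_rel A B `` {v}"]) simp_all
qed

lemma free_product_inl_hom: "free_product_inl A B \<in> hom A (free_product A B)"
  by (auto simp: hom_def free_product_inl_def free_product_mult fp_class_eq_iff
      intro: fp_sym fp_Inl_mult)

lemma free_product_inr_hom: "free_product_inr A B \<in> hom B (free_product A B)"
  by (auto simp: hom_def free_product_inr_def free_product_mult fp_class_eq_iff
      intro: fp_sym fp_Inr_mult)

context
  fixes H :: "('c, 'l) monoid_scheme" and f g
  assumes H: "group H" and f: "f \<in> hom A H" and g: "g \<in> hom B H"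
begin

interpretation H: group H by (rule H)

lemma fp_eval_closed: "w \<in> fp_words A B \<Longrightarrow> fp_eval H f g w \<in> carrier H"
  by (induction rule: fp_words_induct)
     (use f g in \<open>auto simp: fp_eval_def hom_def\<close>)

lemma fp_eval_append:
  "u \<in> fp_words A B \<Longrightarrow> v \<in> fp_words A B \<Longrightarrow>
     fp_eval H f g (u @ v) = fp_eval H f g u \<otimes>\<^bsub>H\<^esub> fp_eval H f g v"
proof (induction rule: fp_words_induct)
  case Nil
  then show ?case using fp_eval_closed[of v] by (simp add: fp_eval_def)
next
  case (Inl a w)
  then show ?case
    using fp_eval_closed[of v] fp_eval_closed[of w] hom_in_carrier[OF f]
    by (simp add: fp_eval_def H.m_assoc)
next
  case (Inr b w)
  then show ?case
    using fp_eval_closed[of v] fp_eval_closed[of w] hom_in_carrier[OF g]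
    by (simp add: fp_eval_def H.m_assoc)
qed

lemma fp_eval_cong: "fp_eq A B u v \<Longrightarrow> fp_eval H f g u = fp_eval H f g v"
proof (induction rule: fp_eq.induct)
  case (fp_append u u' v v')
  then show ?case using fp_eq_words by (simp add: fp_eval_append)
next
  case fp_Inl_one
  then show ?case using hom_one[OF f A.is_group H] by (simp add: fp_eval_def)
next
  case fp_Inr_one
  then show ?case using hom_one[OF g B.is_group H] by (simp add: fp_eval_def)
next
  case (fp_Inl_mult a a')
  then show ?case
    using hom_mult[OF f] hom_in_carrier[OF f] by (simp add: fp_eval_def)
next
  case (fp_Inr_mult b b')
  then show ?case
    using hom_mult[OF g] hom_in_carrier[OF g] by (simp add: fp_eval_def)
qed auto

lemma free_product_lift_class:
  assumes "w \<in> fp_words A B"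
  shows "free_product_lift H f g (fp_rel A B `` {w}) = fp_eval H f g w"
proof -
  have "fp_eval H f g ` (fp_rel A B `` {w}) = {fp_eval H f g w}"
    using fp_refl[OF assms] by (auto simp: fp_rel_def dest: fp_eval_cong)
  then show ?thesis by (simp add: free_product_lift_def)
qed

lemma free_product_lift_hom: "free_product_lift H f g \<in> hom (free_product A B) H"
proof (rule homI)
  fix X assume "X \<in> carrier (free_product A B)"
  then show "free_product_lift H f g X \<in> carrier H"
    by (elim carrier_free_productE) (simp add: free_product_lift_class fp_eval_closed)
next
  fix X Y assume "X \<in> carrier (free_product A B)" "Y \<in> carrier (free_product A B)"
  then show "free_product_lift H f g (X \<otimes>\<^bsub>free_product A B\<^esub> Y) =
      free_product_lift H f g X \<otimes>\<^bsub>H\<^esub> free_product_lift H f g Y"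
  proof (elim carrier_free_productE)
    fix u v
    assume u: "u \<in> fp_words A B" "X = fp_rel A B `` {u}"
      and v: "v \<in> fp_words A B" "Y = fp_rel A B `` {v}"
    have "free_product_lift H f g (fp_rel A B `` {u @ v}) = fp_eval H f g (u @ v)"
      using u(1) v(1) by (intro free_product_lift_class) simp
    then show ?thesis
      unfolding u(2) v(2) free_product_mult[OF u(1) v(1)]
      using free_product_lift_class[OF u(1)] free_product_lift_class[OF v(1)]
        fp_eval_append[OF u(1) v(1)] by argo
  qed
qed

lemma free_product_lift_inl:
  assumes "a \<in> carrier A"
  shows "free_product_lift H f g (free_product_inl A B a) = f a"
proof -
  have "[Inl a] \<in> fp_words A B" using assms by simp
  moreover have "f a \<in> carrier H" using f assms by (rule hom_in_carrier)
  ultimately show ?thesis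
    unfolding free_product_inl_def by (subst free_product_lift_class) (simp_all add: fp_eval_def)
qed

lemma free_product_lift_inr:
  assumes "b \<in> carrier B"
  shows "free_product_lift H f g (free_product_inr A B b) = g b"
proof -
  have "[Inr b] \<in> fp_words A B" using assms by simp
  moreover have "g b \<in> carrier H" using g assms by (rule hom_in_carrier)
  ultimately show ?thesis
    unfolding free_product_inr_def by (subst free_product_lift_class) (simp_all add: fp_eval_def)
qed

lemma free_product_lift_unique:
  assumes h: "h \<in> hom (free_product A B) H"
    and hl: "\<And>a. a \<in> carrier A \<Longrightarrow> h (free_product_inl A B a) = f a"
    and hr: "\<And>b. b \<in> carrier B \<Longrightarrow> h (free_product_inr A B b) = g b"
    and X: "X \<in> carrier (free_product A B)"
  shows "h X = free_product_lift H f g X"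
proof -
  have "h (fp_rel A B `` {w}) = fp_eval H f g w" if "w \<in> fp_words A B" for w
    using that
  proof (induction rule: fp_words_induct)
    case Nil
    then show ?case
      using hom_one[OF h group_free_product H] by (simp add: free_product_one fp_eval_def)
  next
    case (Inl a w)
    have "h (fp_rel A B `` {Inl a # w}) =
        h (free_product_inl A B a \<otimes>\<^bsub>free_product A B\<^esub> fp_rel A B `` {w})"
      using Inl free_product_mult[of "[Inl a]" w] by (simp add: free_product_inl_def)
    also have "\<dots> = f a \<otimes>\<^bsub>H\<^esub> fp_eval H f g w"
      using Inl hom_mult[OF h] hl hom_in_carrier[OF free_product_inl_hom] by simp
    finally show ?case by (simp add: fp_eval_def)
  next
    case (Inr b w)
    have "h (fp_rel A B `` {Inr b # w}) =
        h (free_product_inr A B b \<otimes>\<^bsub>free_product A B\<^esub> fp_rel A B `` {w})"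
      using Inr free_product_mult[of "[Inr b]" w] by (simp add: free_product_inr_def)
    also have "\<dots> = g b \<otimes>\<^bsub>H\<^esub> fp_eval H f g w"
      using Inr hom_mult[OF h] hr hom_in_carrier[OF free_product_inr_hom] by simp
    finally show ?case by (simp add: fp_eval_def)
  qed
  with X show ?thesis
    by (elim carrier_free_productE) (simp add: free_product_lift_class)
qed

end

end


section \<open>The Lie group $\mathrm{PSL}_2(\mathbb{R})^n$\<close>

definition SL2 :: "(real^2^2) monoid" where
  "SL2 = \<lparr>carrier = {M. det M = 1}, monoid.mult = (**), one = mat 1\<rparr>"

definition PSL2 :: "(real^2^2) set monoid" where
  "PSL2 = SL2 Mod {mat 1, - mat 1}"

definition PSL2_proj :: "real^2^2 \<Rightarrow> (real^2^2) set" where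
  "PSL2_proj M = {mat 1, - mat 1} #>\<^bsub>SL2\<^esub> M"

text \<open>
  The quotient topology induced from \<open>SL2\<close>, which is topologised as a subspace of the space of
  all matrices; see \<open>quotient_map_PSL2_proj\<close> below.
\<close>

definition PSL2_top :: "(real^2^2) set topology" where
  "PSL2_top = topology (\<lambda>U. U \<subseteq> carrier PSL2 \<and>
     openin (top_of_set (carrier SL2)) {M \<in> carrier SL2. PSL2_proj M \<in> U})"

text \<open>
  The coordinates of $\mathbb{R}^n$ are indexed by the finite type \<^typ>\<open>'n\<close>, and
  $\mathrm{PSL}_2(\mathbb{R}^n)$ is realised as the product group with the product topology.
\<close>

definition PSL2n :: "('n::finite \<Rightarrow> (real^2^2) set) monoid" where
  "PSL2n = product_group UNIV (\<lambda>_. PSL2)"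

definition PSL2n_top :: "('n::finite \<Rightarrow> (real^2^2) set) topology" where
  "PSL2n_top = product_topology (\<lambda>_. PSL2_top) UNIV"

definition T_mat :: "real \<Rightarrow> real^2^2" where
  "T_mat x = vector [vector [1, x], vector [0, 1]]"

definition V_mat :: "real \<Rightarrow> real^2^2" where
  "V_mat x = vector [vector [1, 0], vector [x, 1]]"

definition T_elt :: "real^'n \<Rightarrow> 'n::finite \<Rightarrow> (real^2^2) set" where
  "T_elt x = (\<lambda>j. PSL2_proj (T_mat (x $ j)))"

definition V_elt :: "real^'n \<Rightarrow> 'n::finite \<Rightarrow> (real^2^2) set" where
  "V_elt x = (\<lambda>j. PSL2_proj (V_mat (x $ j)))"

text \<open>Full-rank lattices: the integer spans of bases of $\mathbb{R}^n$.\<close>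

definition is_lattice :: "(real^'n::finite) set \<Rightarrow> bool" where
  "is_lattice L \<longleftrightarrow>
     (\<exists>B. independent B \<and> span B = UNIV \<and>
          L = {\<Sum>b\<in>B. of_int (c b) *\<^sub>R b | c :: real^'n \<Rightarrow> int. True})"

definition Gamma_upp :: "(real^'n::finite) set \<Rightarrow> ('n \<Rightarrow> (real^2^2) set) set" where
  "Gamma_upp L = T_elt ` L"

definition Gamma_low :: "(real^'n::finite) set \<Rightarrow> ('n \<Rightarrow> (real^2^2) set) set" where
  "Gamma_low L = V_elt ` L"

definition Gamma_grp :: "(real^'n::finite) set \<Rightarrow> (real^'n) set \<Rightarrow> ('n \<Rightarrow> (real^2^2) set) set" where
  "Gamma_grp L1 L2 = generate PSL2n (Gamma_upp L1 \<union> Gamma_low L2)"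

definition is_discrete_in_PSL2n :: "('n::finite \<Rightarrow> (real^2^2) set) set \<Rightarrow> bool" where
  "is_discrete_in_PSL2n S \<longleftrightarrow> subtopology PSL2n_top S = discrete_topology S"

definition Gamma_canonical ::
    "(real^'n::finite) set \<Rightarrow> (real^'n) set \<Rightarrow>
     (('n \<Rightarrow> (real^2^2) set) + ('n \<Rightarrow> (real^2^2) set)) list set \<Rightarrow> 'n \<Rightarrow> (real^2^2) set" where
  "Gamma_canonical L1 L2 = free_product_lift (PSL2n\<lparr>carrier := Gamma_grp L1 L2\<rparr>) id id"


subsection \<open>Well-definedness\<close>

lemma group_SL2: "group SL2"
proof (rule groupI)
  fix M assume "M \<in> carrier SL2"
  then have M: "det M = 1" by (simp add: SL2_def)
  then have "invertible M" by (simp add: invertible_det_nz)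
  then obtain N where N: "N ** M = mat 1" unfolding invertible_def by blast
  then have "det N = 1"
    using M det_mul[of N M] by simp
  with N show "\<exists>N\<in>carrier SL2. N \<otimes>\<^bsub>SL2\<^esub> M = \<one>\<^bsub>SL2\<^esub>"
    by (auto simp: SL2_def)
qed (auto simp: SL2_def det_mul matrix_mul_assoc)

lemma minus_matrix_mult: "(- A) ** B = - (A ** B)" "A ** (- B) = - (A ** B)"
  for A B :: "real^2^2"
  by (simp_all add: matrix_matrix_mult_def vec_eq_iff sum_negf)

lemma center_normal: "{mat 1, - mat 1} \<lhd> SL2"
proof -
  interpret group SL2 by (rule group_SL2)
  have det: "det (- mat 1 :: real^2^2) = 1" by (simp add: det_2 mat_def)
  have "subgroup {mat 1, - mat 1} SL2"
  proof (rule subgroupI)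
    fix M :: "real^2^2" assume M: "M \<in> {mat 1, - mat 1}"
    then have "M \<in> carrier SL2" "M \<otimes>\<^bsub>SL2\<^esub> M = \<one>\<^bsub>SL2\<^esub>"
      by (auto simp: SL2_def minus_matrix_mult det)
    then have "inv\<^bsub>SL2\<^esub> M = M" by (simp add: inv_equality)
    then show "inv\<^bsub>SL2\<^esub> M \<in> {mat 1, - mat 1}" using M by simp
  qed (auto simp: SL2_def minus_matrix_mult det)
  then show ?thesis
    by (rule normalI) (auto simp: SL2_def r_coset_def l_coset_def minus_matrix_mult)
qed

lemma group_PSL2: "group PSL2"
  unfolding PSL2_def by (rule normal.factorgroup_is_group[OF center_normal])

lemma group_PSL2n: "group PSL2n"
  unfolding PSL2n_def by (simp add: group_PSL2)

lemma carrier_PSL2: "carrier PSL2 = PSL2_proj ` carrier SL2"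
  by (auto simp: PSL2_def PSL2_proj_def carrier_FactGroup)

lemma PSL2_proj_eq: "PSL2_proj M = {M, - M}"
  by (auto simp: PSL2_proj_def r_coset_def SL2_def minus_matrix_mult)

lemma PSL2_proj_mult:
  "M \<in> carrier SL2 \<Longrightarrow> N \<in> carrier SL2 \<Longrightarrow> PSL2_proj M \<otimes>\<^bsub>PSL2\<^esub> PSL2_proj N = PSL2_proj (M ** N)"
  using normal.rcos_sum[OF center_normal, of M N]
  by (simp add: PSL2_def PSL2_proj_def) (simp add: SL2_def)

lemma openin_PSL2_top:
  "openin PSL2_top U \<longleftrightarrow> U \<subseteq> carrier PSL2 \<and>
     openin (top_of_set (carrier SL2)) {M \<in> carrier SL2. PSL2_proj M \<in> U}"
proof -
  have "istopology (\<lambda>U. U \<subseteq> carrier PSL2 \<and>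
     openin (top_of_set (carrier SL2)) {M \<in> carrier SL2. PSL2_proj M \<in> U})"
    unfolding istopology_def
  proof (intro conjI allI impI; (elim conjE)?)
    fix S T
    assume "openin (top_of_set (carrier SL2)) {M \<in> carrier SL2. PSL2_proj M \<in> S}"
      and "openin (top_of_set (carrier SL2)) {M \<in> carrier SL2. PSL2_proj M \<in> T}"
    then have "openin (top_of_set (carrier SL2))
      ({M \<in> carrier SL2. PSL2_proj M \<in> S} \<inter> {M \<in> carrier SL2. PSL2_proj M \<in> T})"
      by (rule openin_Int)
    moreover have "{M \<in> carrier SL2. PSL2_proj M \<in> S} \<inter> {M \<in> carrier SL2. PSL2_proj M \<in> T} =
      {M \<in> carrier SL2. PSL2_proj M \<in> S \<inter> T}" by auto
    ultimately show "openin (top_of_set (carrier SL2)) {M \<in> carrier SL2. PSL2_proj M \<in> S \<inter> T}"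
      by simp
  next
    fix \<K> :: "(real^2^2) set set set"
    assume "\<forall>K\<in>\<K>. K \<subseteq> carrier PSL2 \<and>
      openin (top_of_set (carrier SL2)) {M \<in> carrier SL2. PSL2_proj M \<in> K}"
    then have "openin (top_of_set (carrier SL2))
        (\<Union>K\<in>\<K>. {M \<in> carrier SL2. PSL2_proj M \<in> K})"
      by (intro openin_Union) auto
    moreover have "(\<Union>K\<in>\<K>. {M \<in> carrier SL2. PSL2_proj M \<in> K}) =
        {M \<in> carrier SL2. PSL2_proj M \<in> \<Union>\<K>}" by auto
    ultimately show "openin (top_of_set (carrier SL2)) {M \<in> carrier SL2. PSL2_proj M \<in> \<Union>\<K>}"
      by simp
  qed blast+
  then show ?thesis by (simp add: PSL2_top_def topology_inverse')
qed

lemma topspace_PSL2_top: "topspace PSL2_top = carrier PSL2"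
proof -
  have "{M \<in> carrier SL2. PSL2_proj M \<in> carrier PSL2} = carrier SL2"
    by (auto simp: carrier_PSL2)
  then have "openin PSL2_top (carrier PSL2)"
    by (simp add: openin_PSL2_top)
  moreover have "topspace PSL2_top \<subseteq> carrier PSL2"
    using openin_PSL2_top openin_topspace by blast
  ultimately show ?thesis by (simp add: openin_subset subset_antisym)
qed

lemma quotient_map_PSL2_proj: "quotient_map (top_of_set (carrier SL2)) PSL2_top PSL2_proj"
  by (auto simp: quotient_map_def topspace_PSL2_top openin_PSL2_top carrier_PSL2)

lemma topspace_PSL2n_top: "topspace PSL2n_top = carrier PSL2n"
  by (simp add: PSL2n_top_def PSL2n_def topspace_PSL2_top)

lemma T_mat_SL2: "T_mat x \<in> carrier SL2" and V_mat_SL2: "V_mat x \<in> carrier SL2"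
  by (simp_all add: SL2_def T_mat_def V_mat_def det_2)

lemma T_mat_add: "T_mat x ** T_mat y = T_mat (x + y)"
  and V_mat_add: "V_mat x ** V_mat y = V_mat (x + y)"
  by (simp_all add: T_mat_def V_mat_def matrix_matrix_mult_def vec_eq_iff forall_2 sum_2)

lemma T_elt_carrier: "T_elt x \<in> carrier PSL2n" and V_elt_carrier: "V_elt x \<in> carrier PSL2n"
  by (auto simp: T_elt_def V_elt_def PSL2n_def carrier_PSL2 T_mat_SL2 V_mat_SL2)

lemma T_elt_add: "T_elt x \<otimes>\<^bsub>PSL2n\<^esub> T_elt y = T_elt (x + y)"
  and V_elt_add: "V_elt x \<otimes>\<^bsub>PSL2n\<^esub> V_elt y = V_elt (x + y)"
  by (auto simp: T_elt_def V_elt_def PSL2n_def product_group_def PSL2_proj_mult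
      T_mat_SL2 V_mat_SL2 T_mat_add V_mat_add)

lemma T_elt_zero: "T_elt 0 = \<one>\<^bsub>PSL2n\<^esub>" and V_elt_zero: "V_elt 0 = \<one>\<^bsub>PSL2n\<^esub>"
proof -
  have "T_mat 0 = mat 1" "V_mat 0 = mat 1"
    by (simp_all add: T_mat_def V_mat_def mat_def vec_eq_iff forall_2)
  then show "T_elt 0 = \<one>\<^bsub>PSL2n\<^esub>" "V_elt 0 = \<one>\<^bsub>PSL2n\<^esub>"
    by (auto simp: T_elt_def V_elt_def PSL2n_def product_group_def PSL2_def PSL2_proj_eq)
qed

lemma is_lattice_zero: "is_lattice L \<Longrightarrow> 0 \<in> L"
  unfolding is_lattice_def by (force intro: exI[of _ "\<lambda>_. 0"])

lemma is_lattice_add: "is_lattice L \<Longrightarrow> x \<in> L \<Longrightarrow> y \<in> L \<Longrightarrow> x + y \<in> L"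
  unfolding is_lattice_def
proof clarify
  fix B :: "(real^'n) set" and c d :: "real^'n \<Rightarrow> int"
  show "\<exists>e. (\<Sum>b\<in>B. of_int (c b) *\<^sub>R b) + (\<Sum>b\<in>B. of_int (d b) *\<^sub>R b) =
      (\<Sum>b\<in>B. of_int (e b) *\<^sub>R b) \<and> True"
    by (intro exI[of _ "\<lambda>b. c b + d b"]) (simp add: sum.distrib scaleR_left_distrib)
qed

lemma is_lattice_uminus: "is_lattice L \<Longrightarrow> x \<in> L \<Longrightarrow> - x \<in> L"
  unfolding is_lattice_def
proof clarify
  fix B :: "(real^'n) set" and c :: "real^'n \<Rightarrow> int"
  show "\<exists>e. - (\<Sum>b\<in>B. of_int (c b) *\<^sub>R b) = (\<Sum>b\<in>B. of_int (e b) *\<^sub>R b) \<and> True"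
    by (intro exI[of _ "\<lambda>b. - c b"]) (simp add: sum_negf)
qed

lemma subgroup_Gamma_upp:
  assumes "is_lattice L" shows "subgroup (Gamma_upp L) PSL2n"
proof -
  interpret group "PSL2n :: ('a \<Rightarrow> (real^2^2) set) monoid" by (rule group_PSL2n)
  show ?thesis
  proof (rule subgroupI)
    fix a assume "a \<in> Gamma_upp L"
    then obtain x where x: "x \<in> L" "a = T_elt x" by (auto simp: Gamma_upp_def)
    have "inv\<^bsub>PSL2n\<^esub> (T_elt x) = T_elt (- x)"
      by (rule inv_equality) (simp_all add: T_elt_add T_elt_zero T_elt_carrier)
    then show "inv\<^bsub>PSL2n\<^esub> a \<in> Gamma_upp L"
      using x is_lattice_uminus[OF assms] by (simp add: Gamma_upp_def)
  qed (use is_lattice_zero[OF assms] is_lattice_add[OF assms] in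
        \<open>auto simp: Gamma_upp_def T_elt_carrier T_elt_add\<close>)
qed

lemma subgroup_Gamma_low:
  assumes "is_lattice L" shows "subgroup (Gamma_low L) PSL2n"
proof -
  interpret group "PSL2n :: ('a \<Rightarrow> (real^2^2) set) monoid" by (rule group_PSL2n)
  show ?thesis
  proof (rule subgroupI)
    fix a assume "a \<in> Gamma_low L"
    then obtain x where x: "x \<in> L" "a = V_elt x" by (auto simp: Gamma_low_def)
    have "inv\<^bsub>PSL2n\<^esub> (V_elt x) = V_elt (- x)"
      by (rule inv_equality) (simp_all add: V_elt_add V_elt_zero V_elt_carrier)
    then show "inv\<^bsub>PSL2n\<^esub> a \<in> Gamma_low L"
      using x is_lattice_uminus[OF assms] by (simp add: Gamma_low_def)
  qed (use is_lattice_zero[OF assms] is_lattice_add[OF assms] in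
        \<open>auto simp: Gamma_low_def V_elt_carrier V_elt_add\<close>)
qed

lemma subgroup_Gamma_grp: "subgroup (Gamma_grp L1 L2) PSL2n"
  unfolding Gamma_grp_def
  by (rule group.generate_is_subgroup[OF group_PSL2n])
     (auto simp: Gamma_upp_def Gamma_low_def T_elt_carrier V_elt_carrier)

lemma Gamma_canonical_hom:
  assumes "is_lattice L1" "is_lattice L2"
  shows "Gamma_canonical L1 L2 \<in>
    hom (free_product (PSL2n\<lparr>carrier := Gamma_upp L1\<rparr>) (PSL2n\<lparr>carrier := Gamma_low L2\<rparr>))
        (PSL2n\<lparr>carrier := Gamma_grp L1 L2\<rparr>)"
proof -
  interpret two_groups "PSL2n\<lparr>carrier := Gamma_upp L1\<rparr>" "PSL2n\<lparr>carrier := Gamma_low L2\<rparr>"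
    unfolding two_groups_def
    using group.subgroup_imp_group[OF group_PSL2n subgroup_Gamma_upp[OF assms(1)]]
      group.subgroup_imp_group[OF group_PSL2n subgroup_Gamma_low[OF assms(2)]] by simp
  have H: "group (PSL2n\<lparr>carrier := Gamma_grp L1 L2\<rparr>)"
    by (rule group.subgroup_imp_group[OF group_PSL2n subgroup_Gamma_grp])
  have sub: "Gamma_upp L1 \<subseteq> Gamma_grp L1 L2" "Gamma_low L2 \<subseteq> Gamma_grp L1 L2"
    unfolding Gamma_grp_def by (blast intro: generate.incl)+
  have id: "id \<in> hom (PSL2n\<lparr>carrier := S\<rparr>) (PSL2n\<lparr>carrier := Gamma_grp L1 L2\<rparr>)"
    if "S \<subseteq> Gamma_grp L1 L2" for S
    using that by (auto intro!: homI)
  show ?thesis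
    unfolding Gamma_canonical_def by (rule free_product_lift_hom[OF H id id]) (rule sub)+
qed

end

theory Submission
  imports Defs
begin

text \<open>
  If \<open>x \<in> L1\<close> and \<open>y \<in> L2\<close> are nonzero with \<open>x y = 0\<close>, then \<open>T\<^sup>x\<close> and \<open>V\<^sup>y\<close> commute, which is
  impossible in a free product. Otherwise, Dirichlet's pigeonhole principle applied to \<open>L1\<close> and
  \<open>L2\<close> with inversely scaled boxes gives infinitely many pairs \<open>(x, y)\<close> for which \<open>u = 1 + x y\<close>
  is bounded and has no zero coordinate. As \<open>L2\<close> has full rank, some \<open>w \<in> L2\<close> puts the lower left
  entry \<open>c = y + u w\<close> of \<open>V\<^sup>y T\<^sup>x V\<^sup>w\<close> into a fixed box away from zero. As \<open>L1\<close> has full rank, some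
  \<open>z \<in> L1\<close> then makes the upper left entry of \<open>T\<^sup>z V\<^sup>y T\<^sup>x V\<^sup>w\<close> bounded, and the determinant bounds
  the last entry. These are infinitely many distinct reduced words with values in a compact set,
  so two of them have the same value in the discrete group.
\<close>

section \<open>Normal forms in free products\<close>

fun fp_reduced :: "('a, 'm) monoid_scheme \<Rightarrow> ('b, 'k) monoid_scheme \<Rightarrow> ('a + 'b) list \<Rightarrow> bool" where
  "fp_reduced A B [] \<longleftrightarrow> True"
| "fp_reduced A B (Inl a # w) \<longleftrightarrow> a \<in> carrier A \<and> a \<noteq> \<one>\<^bsub>A\<^esub> \<and> fp_reduced A B w \<and>
     (\<forall>a' w'. w \<noteq> Inl a' # w')"
| "fp_reduced A B (Inr b # w) \<longleftrightarrow> b \<in> carrier B \<and> b \<noteq> \<one>\<^bsub>B\<^esub> \<and> fp_reduced A B w \<and>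
     (\<forall>b' w'. w \<noteq> Inr b' # w')"

text \<open>The action of one letter on reduced words: it merges with a first letter of the same
  factor, or cancels it. The last two equations apply only when there is no such first
  letter.\<close>

fun fp_cons ::
    "('a, 'm) monoid_scheme \<Rightarrow> ('b, 'k) monoid_scheme \<Rightarrow> 'a + 'b \<Rightarrow> ('a + 'b) list \<Rightarrow> ('a + 'b) list"
where
  "fp_cons A B (Inl a) (Inl a' # w) =
     (if a \<otimes>\<^bsub>A\<^esub> a' = \<one>\<^bsub>A\<^esub> then w else Inl (a \<otimes>\<^bsub>A\<^esub> a') # w)"
| "fp_cons A B (Inr b) (Inr b' # w) =
     (if b \<otimes>\<^bsub>B\<^esub> b' = \<one>\<^bsub>B\<^esub> then w else Inr (b \<otimes>\<^bsub>B\<^esub> b') # w)"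
| "fp_cons A B (Inl a) w = (if a = \<one>\<^bsub>A\<^esub> then w else Inl a # w)"
| "fp_cons A B (Inr b) w = (if b = \<one>\<^bsub>B\<^esub> then w else Inr b # w)"

text \<open>The result of letting \<open>w\<close> act on the empty word. It is constant on
  equivalence classes by \<open>fp_normal_form_cong\<close>, so different values show that two words
  are inequivalent.\<close>

definition fp_normal_form ::
    "('a, 'm) monoid_scheme \<Rightarrow> ('b, 'k) monoid_scheme \<Rightarrow> ('a + 'b) list \<Rightarrow> ('a + 'b) list" where
  "fp_normal_form A B w = foldr (fp_cons A B) w []"

context two_groups
begin

lemma fp_cons_reduced:
  assumes "fp_reduced A B w"
  shows "a \<in> carrier A \<Longrightarrow> fp_reduced A B (fp_cons A B (Inl a) w)"
    and "b \<in> carrier B \<Longrightarrow> fp_reduced A B (fp_cons A B (Inr b) w)"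
proof -
  show "fp_reduced A B (fp_cons A B (Inl a) w)" if "a \<in> carrier A"
  proof (cases w)
    case (Cons s v)
    then show ?thesis using assms that by (cases s) auto
  qed (use that in auto)
  show "fp_reduced A B (fp_cons A B (Inr b) w)" if "b \<in> carrier B"
  proof (cases w)
    case (Cons s v)
    then show ?thesis using assms that by (cases s) auto
  qed (use that in auto)
qed

lemma fp_cons_one:
  assumes "fp_reduced A B w"
  shows "fp_cons A B (Inl \<one>\<^bsub>A\<^esub>) w = w" and "fp_cons A B (Inr \<one>\<^bsub>B\<^esub>) w = w"
proof -
  show "fp_cons A B (Inl \<one>\<^bsub>A\<^esub>) w = w"
  proof (cases w)
    case (Cons s v)
    then show ?thesis using assms by (cases s) auto
  qed auto
  show "fp_cons A B (Inr \<one>\<^bsub>B\<^esub>) w = w"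
  proof (cases w)
    case (Cons s v)
    then show ?thesis using assms by (cases s) auto
  qed auto
qed

text \<open>The catch-all equations of \<open>fp_cons\<close> are split internally into the empty
  word and the word starting in the other factor; this reunites the two cases.\<close>

lemma fp_cons_Inl_not_Inl:
  "(\<forall>a' w'. w \<noteq> Inl a' # w') \<Longrightarrow> fp_cons A B (Inl a) w = (if a = \<one>\<^bsub>A\<^esub> then w else Inl a # w)"
  by (cases "(A, B, Inl a :: 'a + 'b, w)" rule: fp_cons.cases) auto

lemma fp_cons_Inr_not_Inr:
  "(\<forall>b' w'. w \<noteq> Inr b' # w') \<Longrightarrow> fp_cons A B (Inr b) w = (if b = \<one>\<^bsub>B\<^esub> then w else Inr b # w)"
  by (cases "(A, B, Inr b :: 'a + 'b, w)" rule: fp_cons.cases) auto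

text \<open>The delicate case is a first letter \<open>c\<close> cancelled by \<open>a'\<close>:
  then \<open>a\<close> meets the tail \<open>v\<close>, which by reducedness does not start in the
  same factor, and the product of \<open>a\<close>, \<open>a'\<close> and \<open>c\<close> is
  \<open>a\<close>.\<close>

lemma fp_cons_Inl_mult:
  assumes w: "fp_reduced A B w" and a: "a \<in> carrier A" "a' \<in> carrier A"
  shows "fp_cons A B (Inl a) (fp_cons A B (Inl a') w) = fp_cons A B (Inl (a \<otimes>\<^bsub>A\<^esub> a')) w"
proof (cases "\<exists>c v. w = Inl c # v")
  case True
  then obtain c v where [simp]: "w = Inl c # v" by blast
  from w have c: "c \<in> carrier A" "c \<noteq> \<one>\<^bsub>A\<^esub>" and v: "\<forall>a' w'. v \<noteq> Inl a' # w'"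
    by auto
  have "a \<otimes>\<^bsub>A\<^esub> (a' \<otimes>\<^bsub>A\<^esub> c) = a" if "a' \<otimes>\<^bsub>A\<^esub> c = \<one>\<^bsub>A\<^esub>"
    using that a by simp
  then show ?thesis
    using a c fp_cons_Inl_not_Inl[OF v] by (auto simp: A.m_assoc)
next
  case False
  then show ?thesis using a by (auto simp: fp_cons_Inl_not_Inl)
qed

lemma fp_cons_Inr_mult:
  assumes w: "fp_reduced A B w" and b: "b \<in> carrier B" "b' \<in> carrier B"
  shows "fp_cons A B (Inr b) (fp_cons A B (Inr b') w) = fp_cons A B (Inr (b \<otimes>\<^bsub>B\<^esub> b')) w"
proof (cases "\<exists>c v. w = Inr c # v")
  case True
  then obtain c v where [simp]: "w = Inr c # v" by blast
  from w have c: "c \<in> carrier B" "c \<noteq> \<one>\<^bsub>B\<^esub>" and v: "\<forall>b' w'. v \<noteq> Inr b' # w'"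
    by auto
  have "b \<otimes>\<^bsub>B\<^esub> (b' \<otimes>\<^bsub>B\<^esub> c) = b" if "b' \<otimes>\<^bsub>B\<^esub> c = \<one>\<^bsub>B\<^esub>"
    using that b by simp
  then show ?thesis
    using b c fp_cons_Inr_not_Inr[OF v] by (auto simp: B.m_assoc)
next
  case False
  then show ?thesis using b by (auto simp: fp_cons_Inr_not_Inr)
qed

lemma foldr_fp_cons_reduced:
  "w \<in> fp_words A B \<Longrightarrow> fp_reduced A B r \<Longrightarrow> fp_reduced A B (foldr (fp_cons A B) w r)"
  by (induction rule: fp_words_induct) (auto intro: fp_cons_reduced)

text \<open>Van der Waerden's argument: words act on reduced words, and equivalent words act equally.\<close>

lemma foldr_fp_cons_cong:
  "fp_eq A B u v \<Longrightarrow> fp_reduced A B r \<Longrightarrow> foldr (fp_cons A B) u r = foldr (fp_cons A B) v r"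
proof (induction arbitrary: r rule: fp_eq.induct)
  case (fp_append u u' v v')
  then show ?case
    using foldr_fp_cons_reduced fp_eq_words by (metis foldr_append)
qed (simp_all add: fp_cons_one fp_cons_Inl_mult fp_cons_Inr_mult)

lemma fp_normal_form_cong: "fp_eq A B u v \<Longrightarrow> fp_normal_form A B u = fp_normal_form A B v"
  unfolding fp_normal_form_def by (rule foldr_fp_cons_cong) simp_all

end


section \<open>Lattice points\<close>

lemma is_lattice_of_nat_scaleR:
  assumes "is_lattice L" "x \<in> L"
  shows "of_nat m *\<^sub>R x \<in> L"
proof (induction m)
  case 0
  then show ?case using is_lattice_zero[OF assms(1)] by simp
next
  case (Suc m)
  then show ?case using is_lattice_add[OF assms(1,2) Suc] by (simp add: scaleR_left_distrib)
qed

text \<open>Rounding down the coefficients of \<open>s\<close> in a lattice basis moves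
  \<open>s\<close> by at most the sum of the norms of the basis vectors. Full rank enters because
  \<open>s\<close> must lie in the span.\<close>

lemma is_lattice_covering:
  fixes L :: "(real^'n::finite) set"
  assumes "is_lattice L"
  obtains R where "R > 0" "\<And>s. \<exists>y\<in>L. \<forall>j. \<bar>y $ j - s $ j\<bar> \<le> R"
proof -
  obtain B where B: "independent B" "span B = UNIV"
      and L: "L = {\<Sum>b\<in>B. of_int (c b) *\<^sub>R b | c :: real^'n \<Rightarrow> int. True}"
    using assms unfolding is_lattice_def by blast
  have fin: "finite B" using B(1) by (rule independent_imp_finite)
  define R where "R = 1 + (\<Sum>b\<in>B. norm b)"
  have "\<exists>y\<in>L. \<forall>j. \<bar>y $ j - s $ j\<bar> \<le> R" for s
  proof -
    have "s \<in> span B" using B(2) by simp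
    then obtain r where r: "s = (\<Sum>b\<in>B. r b *\<^sub>R b)"
      unfolding span_finite[OF fin] by blast
    define y where "y = (\<Sum>b\<in>B. of_int \<lfloor>r b\<rfloor> *\<^sub>R b)"
    have "norm (y - s) = norm (\<Sum>b\<in>B. (of_int \<lfloor>r b\<rfloor> - r b) *\<^sub>R b)"
      unfolding y_def r by (simp add: sum_subtractf scaleR_left_diff_distrib)
    also have "\<dots> \<le> (\<Sum>b\<in>B. norm ((of_int \<lfloor>r b\<rfloor> - r b) *\<^sub>R b))" by (rule norm_sum)
    also have "\<dots> \<le> (\<Sum>b\<in>B. norm b)"
    proof (rule sum_mono)
      fix b
      have "\<bar>of_int \<lfloor>r b\<rfloor> - r b\<bar> \<le> 1" by linarith
      then show "norm ((of_int \<lfloor>r b\<rfloor> - r b) *\<^sub>R b) \<le> norm b"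
        using mult_right_mono[of "\<bar>of_int \<lfloor>r b\<rfloor> - r b\<bar>" 1 "norm b"] by simp
    qed
    finally have "norm (y - s) \<le> R" by (simp add: R_def)
    then have "\<bar>y $ j - s $ j\<bar> \<le> R" for j
      using component_le_norm_cart[of "y - s" j] by simp
    moreover have "y \<in> L" unfolding L y_def by (intro CollectI exI[of _ "\<lambda>b. \<lfloor>r b\<rfloor>"]) simp
    ultimately show ?thesis by blast
  qed
  moreover have "R > 0" unfolding R_def by (simp add: add_pos_nonneg sum_nonneg)
  ultimately show ?thesis using that by blast
qed

text \<open>Dirichlet's principle: there are \<open>(N + 1) ^ CARD('n)\<close> combinations of the
  basis with coefficients up to \<open>N\<close>. Cutting the range of each coordinate in
  \<open>S\<close> into \<open>K\<close> intervals gives \<open>K ^ card S\<close> cells, so two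
  combinations share a cell; their difference is the vector.\<close>

lemma is_lattice_small_coordinates:
  fixes L :: "(real^'n::finite) set"
  assumes "is_lattice L"
  obtains M where "M > 0"
    "\<And>S N K. \<lbrakk>N \<ge> 1; K \<ge> 1; K ^ card S < (N + 1) ^ CARD('n)\<rbrakk> \<Longrightarrow>
       \<exists>x\<in>L. x \<noteq> 0 \<and> (\<forall>j. \<bar>x $ j\<bar> \<le> M * real N) \<and> (\<forall>j\<in>S. \<bar>x $ j\<bar> \<le> M * real N / real K)"
proof -
  obtain B where B: "independent B" "span B = UNIV"
      and L: "L = {\<Sum>b\<in>B. of_int (c b) *\<^sub>R b | c :: real^'n \<Rightarrow> int. True}"
    using assms unfolding is_lattice_def by blast
  have fin: "finite B" using B(1) by (rule independent_imp_finite)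
  have card_B: "card B = CARD('n)"
    using basis_card_eq_dim[of B UNIV] B by simp
  define M where "M = 1 + (\<Sum>b\<in>B. norm b)"
  have M: "M > 0" unfolding M_def by (simp add: add_pos_nonneg sum_nonneg)
  have "\<exists>x\<in>L. x \<noteq> 0 \<and> (\<forall>j. \<bar>x $ j\<bar> \<le> 2 * M * real N) \<and>
      (\<forall>j\<in>S. \<bar>x $ j\<bar> \<le> 2 * M * real N / real K)"
    if N: "N \<ge> 1" and K: "K \<ge> 1" and less: "K ^ card S < (N + 1) ^ CARD('n)"
    for S :: "'n set" and N K :: nat
  proof -
    define P where "P = (\<lambda>c :: real^'n \<Rightarrow> nat. \<Sum>b\<in>B. real (c b) *\<^sub>R b)"
    define C where "C = (B \<rightarrow>\<^sub>E {..N})"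
    \<comment> \<open>For each coordinate in \<open>S\<close>, the index of the subinterval of
      length \<open>2 * M * N / K\<close> of the interval from \<open>- M * N\<close> to
      \<open>M * N\<close>.\<close>
    define cell where
      "cell = (\<lambda>c. \<lambda>j\<in>S. nat \<lfloor>real K * (P c $ j + M * real N) / (2 * M * real N)\<rfloor>)"
    have MN: "M * real N > 0" using M N by simp
    \<comment> \<open>Strictness, due to the summand 1 in \<open>M\<close>, keeps the cell index
      below \<open>K\<close>.\<close>
    have P_less: "\<bar>P c $ j\<bar> < M * real N" if "c \<in> C" for c j
    proof -
      have "norm (P c) \<le> (\<Sum>b\<in>B. norm (real (c b) *\<^sub>R b))" unfolding P_def by (rule norm_sum)
      also have "\<dots> \<le> (\<Sum>b\<in>B. real N * norm b)"
        by (rule sum_mono) (use that in \<open>auto simp: C_def intro!: mult_right_mono\<close>)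
      also have "\<dots> < M * real N"
        using N by (simp add: M_def sum_distrib_left[symmetric] algebra_simps)
      finally show ?thesis using component_le_norm_cart[of "P c" j] by linarith
    qed
    have "cell ` C \<subseteq> (S \<rightarrow>\<^sub>E {..<K})"
    proof (intro image_subsetI PiE_I)
      fix c j assume c: "c \<in> C" and j: "j \<in> S"
      have b: "- (M * real N) < P c $ j" "P c $ j < M * real N"
        using P_less[OF c, of j] by linarith+
      have "(P c $ j + M * real N) / (2 * M * real N) < 1"
        using b MN by (simp add: divide_less_eq mult.assoc)
      then have "real K * ((P c $ j + M * real N) / (2 * M * real N)) < real K * 1"
        using K by (intro mult_strict_left_mono) auto
      moreover have "real K * ((P c $ j + M * real N) / (2 * M * real N)) \<ge> 0"
        using b MN M by (intro mult_nonneg_nonneg divide_nonneg_nonneg) auto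
      ultimately show "cell c j \<in> {..<K}"
        using j by (simp add: cell_def nat_less_iff floor_less_iff)
    qed (simp add: cell_def)
    then have "card (cell ` C) \<le> K ^ card S"
      using card_mono[of "S \<rightarrow>\<^sub>E {..<K}" "cell ` C"] by (simp add: finite_PiE card_PiE)
    also have "\<dots> < card C"
      using less fin by (simp add: C_def card_PiE card_B)
    finally have "\<not> inj_on cell C"
      using card_image by fastforce
    then obtain c c' where c: "c \<in> C" "c' \<in> C" "cell c = cell c'" "c \<noteq> c'"
      unfolding inj_on_def by blast
    define x where "x = P c - P c'"
    have x: "x = (\<Sum>b\<in>B. of_int (int (c b) - int (c' b)) *\<^sub>R b)"
      by (simp add: x_def P_def sum_subtractf scaleR_left_diff_distrib)
    have "x \<in> L" unfolding L x
      by (intro CollectI exI[of _ "\<lambda>b. int (c b) - int (c' b)"]) simp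
    moreover have "x \<noteq> 0"
    proof
      assume "x = 0"
      then have zero: "(\<Sum>b\<in>B. of_int (int (c b) - int (c' b)) *\<^sub>R b) = 0" unfolding x .
      have "of_int (int (c b) - int (c' b)) = (0::real)" if "b \<in> B" for b
        by (rule independentD[OF B(1) fin order_refl zero that])
      then have "c b = c' b" if "b \<in> B" for b using that by force
      then have "c = c'" using c(1,2) unfolding C_def by (intro PiE_ext)
      with c(4) show False by simp
    qed
    moreover have "\<bar>x $ j\<bar> \<le> 2 * M * real N" for j
      using P_less[OF c(1), of j] P_less[OF c(2), of j] by (simp add: x_def)
    moreover have "\<bar>x $ j\<bar> \<le> 2 * M * real N / real K" if j: "j \<in> S" for j
    proof -
      define t where "t = (\<lambda>c. real K * (P c $ j + M * real N) / (2 * M * real N))"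
      have pos: "t c \<ge> 0" if "c \<in> C" for c
        using P_less[OF that, of j] MN M unfolding t_def
        by (intro divide_nonneg_nonneg mult_nonneg_nonneg) auto
      have "nat \<lfloor>t c\<rfloor> = nat \<lfloor>t c'\<rfloor>"
        using fun_cong[OF c(3), of j] j by (simp add: cell_def t_def)
      then have "\<lfloor>t c\<rfloor> = \<lfloor>t c'\<rfloor>" using pos[OF c(1)] pos[OF c(2)]
        by (metis eq_nat_nat_iff zero_le_floor)
      then have "\<bar>t c - t c'\<bar> \<le> 1" by linarith
      also have "t c - t c' = real K * (x $ j) / (2 * M * real N)"
        unfolding t_def x_def by (simp add: diff_divide_distrib[symmetric] algebra_simps)
      finally show ?thesis
        using MN M K N by (simp add: abs_mult field_simps)
    qed
    ultimately show ?thesis by blast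
  qed
  then show ?thesis using that[of "2 * M"] M by simp
qed


section \<open>Discreteness\<close>

lemma PSL2n_mult_proj:
  assumes "\<And>j. det (M j) = 1" "\<And>j. det (N j) = 1"
  shows "(\<lambda>j. PSL2_proj (M j)) \<otimes>\<^bsub>PSL2n\<^esub> (\<lambda>j. PSL2_proj (N j)) = (\<lambda>j. PSL2_proj (M j ** N j))"
  using assms by (auto simp: PSL2n_def product_group_def PSL2_proj_mult SL2_def)

lemma PSL2n_one_proj: "\<one>\<^bsub>PSL2n\<^esub> = (\<lambda>j. PSL2_proj (mat 1))"
  by (auto simp: PSL2n_def product_group_def PSL2_def PSL2_proj_eq)

text \<open>An open set isolating the identity contains a box of open sets; each pulls back to
  \<open>SL2\<close> and there contains a ball around \<open>mat 1\<close>. With finitely many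
  coordinates the least radius is positive.\<close>

lemma discrete_near_one:
  fixes S :: "('n::finite \<Rightarrow> (real^2^2) set) set"
  assumes disc: "is_discrete_in_PSL2n S" and one: "\<one>\<^bsub>PSL2n\<^esub> \<in> S"
  obtains e where "e > 0"
    "\<And>M. \<lbrakk>\<And>j. det (M j) = 1; \<And>j. dist (M j) (mat 1) < e; (\<lambda>j. PSL2_proj (M j)) \<in> S\<rbrakk> \<Longrightarrow>
       (\<lambda>j. PSL2_proj (M j)) = \<one>\<^bsub>PSL2n\<^esub>"
proof -
  have "openin (subtopology PSL2n_top S) {\<one>\<^bsub>PSL2n\<^esub>}"
    using disc one by (simp add: is_discrete_in_PSL2n_def)
  then obtain U where U: "openin PSL2n_top U" "{\<one>\<^bsub>PSL2n\<^esub>} = U \<inter> S"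
    by (auto simp: openin_subtopology)
  have "\<one>\<^bsub>PSL2n\<^esub> \<in> U" using U(2) by blast
  then obtain X where X: "\<one>\<^bsub>PSL2n\<^esub> \<in> (\<Pi>\<^sub>E i\<in>UNIV. X i)" "\<And>i. openin PSL2_top (X i)"
      "(\<Pi>\<^sub>E i\<in>UNIV. X i) \<subseteq> U"
    using product_topology_open_contains_basis[of "\<lambda>_. PSL2_top" UNIV U] U(1)
    unfolding PSL2n_top_def by metis
  have "\<exists>e>0. \<forall>M. det M = 1 \<and> dist M (mat 1) < e \<longrightarrow> PSL2_proj M \<in> X j" for j
  proof -
    have "openin (top_of_set (carrier SL2)) {M \<in> carrier SL2. PSL2_proj M \<in> X j}"
      using X(2)[of j] by (simp add: openin_PSL2_top)
    moreover have "mat 1 \<in> {M \<in> carrier SL2. PSL2_proj M \<in> X j}"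
      using X(1) by (auto simp: PSL2n_one_proj SL2_def PiE_iff)
    ultimately obtain e where "e > 0"
        "\<forall>M\<in>carrier SL2. dist M (mat 1) < e \<longrightarrow> M \<in> {M \<in> carrier SL2. PSL2_proj M \<in> X j}"
      unfolding openin_euclidean_subtopology_iff by meson
    then show ?thesis by (auto simp: SL2_def)
  qed
  then obtain e where e: "\<And>j. e j > 0"
      "\<And>j M. det M = 1 \<Longrightarrow> dist M (mat 1) < e j \<Longrightarrow> PSL2_proj M \<in> X j"
    by metis
  show ?thesis
  proof (rule that[of "Min (range e)"])
    show "Min (range e) > 0" using e(1) by simp
  next
    fix M :: "'n \<Rightarrow> real^2^2"
    assume M: "\<And>j. det (M j) = 1" "\<And>j. dist (M j) (mat 1) < Min (range e)"
      "(\<lambda>j. PSL2_proj (M j)) \<in> S"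
    have "PSL2_proj (M j) \<in> X j" for j
      using M(1,2)[of j] by (intro e(2)) auto
    then have "(\<lambda>j. PSL2_proj (M j)) \<in> U" using X(3) by auto
    then show "(\<lambda>j. PSL2_proj (M j)) = \<one>\<^bsub>PSL2n\<^esub>" using M(3) U(2) by blast
  qed
qed

text \<open>The adjugate: an inverse for determinant 1 whose entries are those of \<open>M\<close>
  up to sign and position, so entry bounds carry over.\<close>

definition adj2 :: "real^2^2 \<Rightarrow> real^2^2" where
  "adj2 M = vector [vector [M $ 2 $ 2, - M $ 1 $ 2], vector [- M $ 2 $ 1, M $ 1 $ 1]]"

lemma det_adj2: "det (adj2 M) = det M"
  by (simp add: adj2_def det_2)

lemma adj2_mult: "det M = 1 \<Longrightarrow> adj2 M ** M = mat 1"
  by (simp add: adj2_def det_2 matrix_matrix_mult_def mat_def vec_eq_iff forall_2 sum_2 algebra_simps)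

section \<open>Norms and entries of 2 by 2 matrices\<close>

lemma matrix_diff_ldistrib2: "A ** (B - C) = A ** B - A ** C" for A B C :: "real^2^2"
  by (simp add: matrix_matrix_mult_def vec_eq_iff sum_subtractf right_diff_distrib)

lemma norm_matrix2_le:
  fixes M :: "real^2^2"
  assumes "\<And>i j. \<bar>M $ i $ j\<bar> \<le> C"
  shows "norm M \<le> 4 * C"
proof -
  have row: "norm (M $ i) \<le> 2 * C" for i
    using norm_le_l1_cart[of "M $ i"] assms[of i 1] assms[of i 2] by (simp add: sum_2)
  have "norm M \<le> (\<Sum>i\<in>UNIV. norm (M $ i))"
    unfolding norm_vec_def by (rule L2_set_le_sum) simp
  then show ?thesis using row[of 1] row[of 2] by (simp add: sum_2)
qed

lemma entry_le_norm: "\<bar>(M :: real^2^2) $ i $ j\<bar> \<le> norm M"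
  using component_le_norm_cart[of "M $ i" j] Finite_Cartesian_Product.norm_nth_le[of M i] by linarith

text \<open>Infinitely many bounded representatives would accumulate. Two close ones
  \<open>M\<close> and \<open>N\<close> make \<open>adj2 M ** N\<close> close to the identity in
  every coordinate, hence trivial by discreteness, so both represent the same element.\<close>

lemma discrete_finite_bounded:
  fixes S :: "('n::finite \<Rightarrow> (real^2^2) set) set"
  assumes disc: "is_discrete_in_PSL2n S" and S: "subgroup S PSL2n"
  shows "finite {g \<in> S. \<exists>M. g = (\<lambda>j. PSL2_proj (M j)) \<and>
           (\<forall>j. det (M j) = 1) \<and> (\<forall>j r s. \<bar>M j $ r $ s\<bar> \<le> C)}" (is "finite ?F")
proof (rule ccontr)
  assume "infinite ?F"
  moreover define F where "F = ?F"
  ultimately have inf: "infinite F" by simp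
  have FS: "g \<in> S" if "g \<in> F" for g using that by (simp add: F_def)
  interpret G: group "PSL2n :: ('n \<Rightarrow> (real^2^2) set) monoid" by (rule group_PSL2n)
  \<comment> \<open>Representatives are taken in \<open>real^2^2^'n\<close> rather than as
    functions, so that Bolzano-Weierstrass applies.\<close>
  have "\<forall>g\<in>F. \<exists>M :: real^2^2^'n. g = (\<lambda>j. PSL2_proj (M $ j)) \<and>
      (\<forall>j. det (M $ j) = 1) \<and> (\<forall>j r s. \<bar>M $ j $ r $ s\<bar> \<le> C)"
  proof
    fix g assume "g \<in> F"
    then obtain M where "g = (\<lambda>j. PSL2_proj (M j))" "\<forall>j. det (M j) = 1"
      "\<forall>j r s. \<bar>M j $ r $ s\<bar> \<le> C" unfolding F_def by blast
    then show "\<exists>M :: real^2^2^'n. g = (\<lambda>j. PSL2_proj (M $ j)) \<and>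
      (\<forall>j. det (M $ j) = 1) \<and> (\<forall>j r s. \<bar>M $ j $ r $ s\<bar> \<le> C)"
      by (intro exI[of _ "\<chi> j. M j"]) simp
  qed
  from bchoice[OF this] obtain rep :: "_ \<Rightarrow> real^2^2^'n"
    where rep0: "\<forall>g\<in>F. g = (\<lambda>j. PSL2_proj (rep g $ j)) \<and>
      (\<forall>j. det (rep g $ j) = 1) \<and> (\<forall>j r s. \<bar>rep g $ j $ r $ s\<bar> \<le> C)" ..
  have rep:
      "\<And>g. g \<in> F \<Longrightarrow> g = (\<lambda>j. PSL2_proj (rep g $ j))"
      "\<And>g j. g \<in> F \<Longrightarrow> det (rep g $ j) = 1"
      "\<And>g j r s. g \<in> F \<Longrightarrow> \<bar>rep g $ j $ r $ s\<bar> \<le> C"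
    using rep0 by blast+
  have inj: "inj_on rep F"
  proof (rule inj_onI)
    fix g h assume gh: "g \<in> F" "h \<in> F" "rep g = rep h"
    have "g = (\<lambda>j. PSL2_proj (rep g $ j))" by (rule rep(1)[OF gh(1)])
    also have "\<dots> = h" unfolding gh(3) by (rule rep(1)[OF gh(2), symmetric])
    finally show "g = h" .
  qed
  then have inf': "infinite (rep ` F)" using inf finite_imageD by blast
  have C: "C \<ge> 0"
  proof -
    obtain g where "g \<in> F" using inf by fastforce
    from rep(3)[OF this, of undefined 1 1] show ?thesis by linarith
  qed
  have "bounded (rep ` F)"
  proof (rule boundedI)
    fix M assume "M \<in> rep ` F"
    then have "norm (M $ j) \<le> 4 * C" for j
      using rep(3) by (intro norm_matrix2_le) auto
    then have "(\<Sum>j\<in>UNIV. norm (M $ j)) \<le> (\<Sum>j::'n\<in>UNIV. 4 * C)" by (intro sum_mono)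
    moreover have "norm M \<le> (\<Sum>j\<in>UNIV. norm (M $ j))"
      unfolding norm_vec_def by (rule L2_set_le_sum) simp
    ultimately show "norm M \<le> (\<Sum>j::'n\<in>UNIV. 4 * C)" by linarith
  qed
  then obtain l where l: "l islimpt rep ` F"
    using inf' bounded_infinite_imp_islimpt[OF order_refl] by blast
  obtain e where e: "e > 0"
    "\<And>M. \<lbrakk>\<And>j. det (M j) = 1; \<And>j. dist (M j) (mat 1) < e; (\<lambda>j. PSL2_proj (M j)) \<in> S\<rbrakk> \<Longrightarrow>
       (\<lambda>j. PSL2_proj (M j)) = \<one>\<^bsub>PSL2n\<^esub>"
    using discrete_near_one[OF disc subgroup.one_closed[OF S]] by blast
  \<comment> \<open>The estimate below gives distance at most \<open>8 * C * d\<close>, which must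
    stay below \<open>e\<close>; the added 1 covers \<open>C = 0\<close>.\<close>
  define d where "d = e / (8 * C + 1) / 2"
  have d: "d > 0" using e C by (simp add: d_def)
  obtain M where M: "M \<in> rep ` F" "M \<noteq> l" "dist M l < d / 2"
    using l d unfolding islimpt_approachable by (meson half_gt_zero)
  \<comment> \<open>Being strictly closer to \<open>l\<close> than \<open>M\<close> is,
    \<open>N\<close> differs from \<open>M\<close>.\<close>
  obtain N where N: "N \<in> rep ` F" "N \<noteq> l" "dist N l < min (d / 2) (dist M l)"
    using l d M(2) unfolding islimpt_approachable
    by (metis half_gt_zero min_less_iff_conj zero_less_dist_iff)
  have "M \<noteq> N" using N(3) by auto
  obtain g h where g: "g \<in> F" "M = rep g" and h: "h \<in> F" "N = rep h" using M N by blast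
  have gM: "g = (\<lambda>j. PSL2_proj (M $ j))" and hN: "h = (\<lambda>j. PSL2_proj (N $ j))"
    unfolding g(2) h(2) by (rule rep(1)[OF g(1)], rule rep(1)[OF h(1)])
  have det: "det (M $ j) = 1" "det (N $ j) = 1" for j
    using rep(2)[OF g(1)] rep(2)[OF h(1)] g(2) h(2) by metis+
  have entry: "\<bar>M $ j $ r $ s\<bar> \<le> C" for j r s
    using rep(3)[OF g(1)] g(2) by metis
  have "dist M N < d" using M(3) N(3) dist_triangle_half_l[of M l d N] by simp
  then have MN: "norm (N - M) < d" by (simp add: dist_norm norm_minus_commute)
  define Q where "Q = (\<lambda>j. adj2 (M $ j) ** (N $ j))"
  have proj_adj: "(\<lambda>j. PSL2_proj (adj2 (M $ j))) = inv\<^bsub>PSL2n\<^esub> g"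
  proof (rule G.inv_equality[symmetric])
    show "(\<lambda>j. PSL2_proj (adj2 (M $ j))) \<otimes>\<^bsub>PSL2n\<^esub> g = \<one>\<^bsub>PSL2n\<^esub>"
      unfolding gM by (subst PSL2n_mult_proj) (simp_all add: det det_adj2 adj2_mult PSL2n_one_proj)
    show "g \<in> carrier PSL2n" using FS[OF g(1)] subgroup.subset[OF S] by blast
    show "(\<lambda>j. PSL2_proj (adj2 (M $ j))) \<in> carrier PSL2n"
      by (auto simp: PSL2n_def carrier_PSL2 SL2_def det det_adj2)
  qed
  have projQ: "(\<lambda>j. PSL2_proj (Q j)) = inv\<^bsub>PSL2n\<^esub> g \<otimes>\<^bsub>PSL2n\<^esub> h"
    unfolding proj_adj[symmetric] Q_def hN by (subst PSL2n_mult_proj) (simp_all add: det det_adj2)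
  have "(\<lambda>j. PSL2_proj (Q j)) = \<one>\<^bsub>PSL2n\<^esub>"
  proof (rule e(2))
    show "det (Q j) = 1" for j
      by (simp add: Q_def det det_mul det_adj2)
    show "(\<lambda>j. PSL2_proj (Q j)) \<in> S"
      unfolding projQ using FS[OF g(1)] FS[OF h(1)] subgroup.m_closed[OF S] subgroup.m_inv_closed[OF S]
      by blast
    show "dist (Q j) (mat 1) < e" for j
    proof -
      have "Q j - mat 1 = adj2 (M $ j) ** (N $ j - M $ j)"
        using adj2_mult[OF det(1)[of j]] unfolding Q_def
        by (metis matrix_diff_ldistrib2)
      moreover have "\<bar>(adj2 (M $ j) ** (N $ j - M $ j)) $ r $ s\<bar> \<le> 2 * C * d" for r s
      proof -
        have a: "\<bar>adj2 (M $ j) $ r $ i\<bar> \<le> C" for r i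
          using exhaust_2[of r] exhaust_2[of i] by (auto simp: adj2_def entry)
        have "\<bar>(N $ j - M $ j) $ i $ s\<bar> \<le> d" for i
          using entry_le_norm[of "N $ j - M $ j" i s] Finite_Cartesian_Product.norm_nth_le[of "N - M" j] MN by simp
        then have "\<bar>adj2 (M $ j) $ r $ i * (N $ j - M $ j) $ i $ s\<bar> \<le> C * d" for i
          unfolding abs_mult using a C by (intro mult_mono) auto
        from this[of 1] this[of 2] show ?thesis
          by (simp add: matrix_matrix_mult_def sum_2)
      qed
      ultimately have "norm (Q j - mat 1) \<le> 4 * (2 * C * d)"
        by (metis norm_matrix2_le)
      also have "\<dots> < e"
      proof -
        have "4 * (2 * C * d) \<le> (8 * C + 1) * d" using d by (simp add: algebra_simps)
        also have "\<dots> = e / 2"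
        proof -
          have "8 * C + 1 \<noteq> 0" using C by linarith
          then show ?thesis
            unfolding d_def by (metis nonzero_mult_div_cancel_left times_divide_eq_right)
        qed
        finally show ?thesis using e(1) by simp
      qed
      finally show ?thesis by (simp add: dist_norm)
    qed
  qed
  then have "inv\<^bsub>PSL2n\<^esub> g \<otimes>\<^bsub>PSL2n\<^esub> h = \<one>\<^bsub>PSL2n\<^esub>" using projQ by simp
  moreover have "g \<in> carrier PSL2n" "h \<in> carrier PSL2n"
    using FS[OF g(1)] FS[OF h(1)] subgroup.subset[OF S] by blast+
  ultimately have "g = h" by (metis G.inv_closed G.inv_equality G.inv_inv)
  with \<open>M \<noteq> N\<close> g(2) h(2) show False by simp
qed



section \<open>Short words with bounded entries\<close>

text \<open>Each coordinate rules out at most one \<open>m\<close>, and there is one more candidate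
  than there are coordinates.\<close>

lemma exists_multiplier:
  fixes t :: "'n::finite \<Rightarrow> real"
  shows "\<exists>m\<in>{1..CARD('n) + 1}. \<forall>j. 1 + real m * t j \<noteq> 0"
proof (rule ccontr)
  assume "\<not> ?thesis"
  then have "\<forall>m\<in>{1..CARD('n) + 1}. \<exists>j. 1 + real m * t j = 0" by blast
  then obtain f where f: "\<And>m. m \<in> {1..CARD('n) + 1} \<Longrightarrow> 1 + real m * t (f m) = 0" by metis
  have "inj_on f {1..CARD('n) + 1}"
  proof (rule inj_onI)
    fix m m' assume m: "m \<in> {1..CARD('n) + 1}" "m' \<in> {1..CARD('n) + 1}" and "f m = f m'"
    then have "1 + real m * t (f m) = 0" "1 + real m' * t (f m) = 0"
      using f[of m] f[of m'] by simp_all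
    then have "real m * t (f m) = real m' * t (f m)" "t (f m) \<noteq> 0"
      by (linarith, force)
    then show "m = m'" by simp
  qed
  then have "card {1..CARD('n) + 1} \<le> CARD('n)"
    by (intro card_inj_on_le[of f _ UNIV]) auto
  then show False by simp
qed

lemma zero_if_bounded_by_inverse:
  fixes t C :: real
  assumes "infinite K" "\<And>k. k \<in> K \<Longrightarrow> \<bar>t\<bar> \<le> C / real k"
  shows "t = 0"
proof (rule ccontr)
  assume "t \<noteq> 0"
  obtain n :: nat where n: "C / \<bar>t\<bar> < real n" using reals_Archimedean2 by blast
  obtain k where k: "k \<in> K" "k > n" using assms(1) by (meson infinite_nat_iff_unbounded)
  have "C < real n * \<bar>t\<bar>" using n \<open>t \<noteq> 0\<close> by (simp add: pos_divide_less_eq)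
  also have "\<dots> \<le> real k * \<bar>t\<bar>" using k by (intro mult_right_mono) auto
  also have "\<dots> \<le> C" using assms(2)[OF k(1)] k by (simp add: pos_le_divide_eq mult.commute)
  finally show False by simp
qed

text \<open>
  The diagonal element \<open>(k, \<dots>, k, k\<^sup>1\<^sup>-\<^sup>n)\<close> moves \<open>L1\<close> and \<open>L2\<close> in opposite directions. Each has
  a nonzero vector that becomes bounded, and a pair of vectors that works for infinitely many \<open>k\<close>
  has disjoint supports.
\<close>

lemma infinite_bounded_pairs:
  fixes L1 L2 :: "(real^'n::finite) set"
  assumes n: "CARD('n) \<ge> 2" and L1: "is_lattice L1" and L2: "is_lattice L2"
    and supp: "\<And>x y. \<lbrakk>x \<in> L1; y \<in> L2; x \<noteq> 0; y \<noteq> 0\<rbrakk> \<Longrightarrow> \<exists>j. x $ j * y $ j \<noteq> 0"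
  obtains U where "infinite {(x, y). x \<in> L1 \<and> y \<in> L2 \<and> x \<noteq> 0 \<and> y \<noteq> 0 \<and>
    (\<forall>j. 1 + x $ j * y $ j \<noteq> 0 \<and> \<bar>1 + x $ j * y $ j\<bar> \<le> U)}"
proof -
  define n where "n = CARD('n)"
  define j0 :: 'n where "j0 = undefined"
  obtain M1 where M1: "M1 > 0"
    "\<And>S N K. \<lbrakk>N \<ge> 1; K \<ge> 1; K ^ card S < (N + 1) ^ CARD('n)\<rbrakk> \<Longrightarrow>
       \<exists>x\<in>L1. x \<noteq> 0 \<and> (\<forall>j. \<bar>x $ j\<bar> \<le> M1 * real N) \<and> (\<forall>j\<in>S. \<bar>x $ j\<bar> \<le> M1 * real N / real K)"
    using is_lattice_small_coordinates[OF L1] by blast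
  obtain M2 where M2: "M2 > 0"
    "\<And>S N K. \<lbrakk>N \<ge> 1; K \<ge> 1; K ^ card S < (N + 1) ^ CARD('n)\<rbrakk> \<Longrightarrow>
       \<exists>x\<in>L2. x \<noteq> 0 \<and> (\<forall>j. \<bar>x $ j\<bar> \<le> M2 * real N) \<and> (\<forall>j\<in>S. \<bar>x $ j\<bar> \<le> M2 * real N / real K)"
    using is_lattice_small_coordinates[OF L2] by blast
  \<comment> \<open>The factor \<open>n + 1\<close> allows for the multiplier \<open>m\<close>
    chosen below.\<close>
  define U where "U = 1 + real (n + 1) * (M1 * M2)"
  define I where "I = {(x, y). x \<in> L1 \<and> y \<in> L2 \<and> x \<noteq> 0 \<and> y \<noteq> 0 \<and>
    (\<forall>j. 1 + x $ j * y $ j \<noteq> 0 \<and> \<bar>1 + x $ j * y $ j\<bar> \<le> U)}"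
  \<comment> \<open>These bounds tend to zero: a fixed pair satisfying them for infinitely many
    \<open>k\<close> has \<open>x\<close> supported at \<open>j0\<close> and \<open>y\<close>
    vanishing there.\<close>
  define Q where "Q = (\<lambda>k (x :: real^'n, y :: real^'n).
    (\<forall>j. j \<noteq> j0 \<longrightarrow> \<bar>x $ j\<bar> \<le> real (n + 1) * M1 / real k) \<and> \<bar>y $ j0\<bar> \<le> M2 / real k)"
  have ex: "\<exists>p\<in>I. Q k p" if k: "k \<ge> 1" for k :: nat
  proof -
    have pow: "k ^ n = k ^ (n - 1) * k" using n by (simp add: n_def power_eq_if)
    have n1: "card (- {j0}) = n - 1" by (simp add: Compl_eq_Diff_UNIV n_def)
    \<comment> \<open>Pigeonhole for \<open>L1\<close> with \<open>N = k ^ (n - 1)\<close> and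
      \<open>K = k ^ n\<close>: \<open>x\<close> is of order \<open>k ^ (n - 1)\<close> at
      \<open>j0\<close> and \<open>1 / k\<close> elsewhere.\<close>
    have "(k ^ n) ^ card (- {j0}) = (k ^ (n - 1)) ^ n"
      unfolding n1 by (simp add: mult.commute flip: power_mult)
    also have "\<dots> < (k ^ (n - 1) + 1) ^ n"
      using n by (intro power_strict_mono) (auto simp: n_def)
    finally have "(k ^ n) ^ card (- {j0}) < (k ^ (n - 1) + 1) ^ CARD('n)" by (simp add: n_def)
    then obtain x where x: "x \<in> L1" "x \<noteq> 0" "\<And>j. \<bar>x $ j\<bar> \<le> M1 * real (k ^ (n - 1))"
        "\<And>j. j \<noteq> j0 \<Longrightarrow> \<bar>x $ j\<bar> \<le> M1 * real (k ^ (n - 1)) / real (k ^ n)"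
      using M1(2)[of "k ^ (n - 1)" "k ^ n" "- {j0}"] k by auto
    have x': "\<bar>x $ j\<bar> \<le> M1 / real k" if "j \<noteq> j0" for j
      using x(4)[OF that] k by (simp add: pow)
    \<comment> \<open>The opposite scaling for \<open>L2\<close>, with \<open>N = k\<close> and the
      same \<open>K\<close>: \<open>y\<close> is of order \<open>k\<close> in general and
      \<open>1 / k ^ (n - 1)\<close> at \<open>j0\<close>. The products with \<open>x\<close> are
      therefore bounded.\<close>
    have "(k ^ n) ^ card {j0} < (k + 1) ^ CARD('n)"
      using n by (auto simp: n_def intro: power_strict_mono)
    then obtain y where y: "y \<in> L2" "y \<noteq> 0" "\<And>j. \<bar>y $ j\<bar> \<le> M2 * real k"
        "\<bar>y $ j0\<bar> \<le> M2 * real k / real (k ^ n)"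
      using M2(2)[of k "k ^ n" "{j0}"] k by auto
    have y': "\<bar>y $ j0\<bar> \<le> M2 / real (k ^ (n - 1))"
      using y(4) k by (simp add: pow)
    have xy: "\<bar>x $ j * y $ j\<bar> \<le> M1 * M2" for j
    proof (cases "j = j0")
      case True
      have "\<bar>x $ j0 * y $ j0\<bar> \<le> (M1 * real (k ^ (n - 1))) * (M2 / real (k ^ (n - 1)))"
        unfolding abs_mult using M1(1) by (intro mult_mono x(3) y') auto
      then show ?thesis using True k by simp
    next
      case False
      have "\<bar>x $ j * y $ j\<bar> \<le> (M1 / real k) * (M2 * real k)"
        unfolding abs_mult using M1(1) by (intro mult_mono x' y(3) False) auto
      then show ?thesis using k by simp
    qed
    \<comment> \<open>Passing from \<open>x\<close> to its multiple by \<open>m\<close> keeps all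
      bounds up to the factor \<open>n + 1\<close> and makes every \<open>1 + x y\<close>
      nonzero.\<close>
    obtain m where m: "m \<in> {1..n + 1}" "\<And>j. 1 + real m * (x $ j * y $ j) \<noteq> 0"
      using exists_multiplier[of "\<lambda>j. x $ j * y $ j"] unfolding n_def by blast
    have mle: "real m \<le> real (n + 1)" using m(1) by simp
    have bound: "\<bar>1 + real m * (x $ j * y $ j)\<bar> \<le> U" for j
    proof -
      have "\<bar>real m * (x $ j * y $ j)\<bar> \<le> real (n + 1) * (M1 * M2)"
        unfolding abs_mult[of "real m"] using mle xy by (intro mult_mono) auto
      then show ?thesis unfolding U_def by linarith
    qed
    have "(real m *\<^sub>R x, y) \<in> I"
      using x(1,2) y(1,2) m bound is_lattice_of_nat_scaleR[OF L1 x(1), of m]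
      by (simp add: I_def mult.assoc)
    moreover have "Q k (real m *\<^sub>R x, y)"
    proof -
      have "\<bar>real m * x $ j\<bar> \<le> real (n + 1) * M1 / real k" if "j \<noteq> j0" for j
        using mult_mono[OF mle x'[OF that]] by (simp add: abs_mult)
      \<comment> \<open>Here \<open>n \<ge> 2\<close> enters: it makes the exponent
        \<open>n - 1\<close> at least 1.\<close>
      moreover have "M2 / real (k ^ (n - 1)) \<le> M2 / real k"
      proof (rule divide_left_mono)
        show "real k \<le> real (k ^ (n - 1))"
          using power_increasing[of 1 "n - 1" "real k"] n k by (simp add: n_def)
      qed (use M2(1) k in auto)
      ultimately show ?thesis using y' by (simp add: Q_def)
    qed
    ultimately show ?thesis by blast
  qed
  have "infinite I"
  proof
    assume fin: "finite I"
    obtain f where f: "\<And>k. k \<ge> 1 \<Longrightarrow> f k \<in> I \<and> Q k (f k)" using ex by metis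
    have "infinite {1 :: nat..}" by (simp add: infinite_Ici)
    moreover have "finite (f ` {1..})" using f by (intro finite_subset[OF _ fin]) auto
    \<comment> \<open>If \<open>I\<close> were finite, one pair would serve infinitely many
      \<open>k\<close>.\<close>
    ultimately obtain k0 where k0: "k0 \<in> {1..}" "infinite {k \<in> {1..}. f k = f k0}"
      using pigeonhole_infinite by blast
    obtain x y where xy: "f k0 = (x, y)" by force
    have *: "Q k (x, y)" if "k \<in> {k \<in> {1..}. f k = f k0}" for k
      using that f[of k] xy by simp
    have "x $ j = 0" if "j \<noteq> j0" for j
      by (rule zero_if_bounded_by_inverse[OF k0(2), of _ "real (n + 1) * M1"])
         (use * that in \<open>simp add: Q_def\<close>)
    moreover have "y $ j0 = 0"
      by (rule zero_if_bounded_by_inverse[OF k0(2), of _ M2]) (use * in \<open>simp add: Q_def\<close>)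
    ultimately have "x $ j * y $ j = 0" for j by (cases "j = j0") auto
    moreover have "(x, y) \<in> I" using f[of k0] k0(1) xy by simp
    ultimately show False using supp[of x y] by (auto simp: I_def)
  qed
  then show ?thesis unfolding I_def by (rule that)
qed

section \<open>Bounding the entries of words of length four\<close>

lemma T_mat_V_mat_word:
  "T_mat z ** (V_mat y ** (T_mat x ** V_mat w)) =
     vector [vector [1 + x * w + z * (y + (1 + x * y) * w), x + z * (1 + x * y)],
             vector [y + (1 + x * y) * w, 1 + x * y]]"
  by (simp add: T_mat_def V_mat_def matrix_matrix_mult_def vec_eq_iff forall_2 sum_2 algebra_simps)

text \<open>With \<open>u = 1 + x y\<close>, the letter \<open>w\<close> shifts the lower left entry
  \<open>c\<close> by \<open>u w\<close>; then \<open>z\<close> shifts the upper left entry by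
  \<open>z c\<close> and leaves the lower row alone. Hence \<open>w\<close> and \<open>z\<close> can
  be chosen in turn by covering.\<close>

lemma bounded_word:
  fixes L1 L2 :: "(real^'n::finite) set"
  assumes L1: "is_lattice L1" and L2: "is_lattice L2"
  obtains C where "\<And>x y. (\<And>j. 1 + x $ j * y $ j \<noteq> 0 \<and> \<bar>1 + x $ j * y $ j\<bar> \<le> U) \<Longrightarrow>
    \<exists>z\<in>L1. \<exists>w\<in>L2. w \<noteq> 0 \<and> (\<forall>j r s.
      \<bar>(T_mat (z $ j) ** (V_mat (y $ j) ** (T_mat (x $ j) ** V_mat (w $ j)))) $ r $ s\<bar> \<le> C)"
proof -
  obtain R1 where R1: "R1 > 0" "\<And>s. \<exists>y\<in>L1. \<forall>j. \<bar>y $ j - s $ j\<bar> \<le> R1"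
    using is_lattice_covering[OF L1] by blast
  obtain R2 where R2: "R2 > 0" "\<And>s. \<exists>y\<in>L2. \<forall>j. \<bar>y $ j - s $ j\<bar> \<le> R2"
    using is_lattice_covering[OF L2] by blast
  \<comment> \<open>The larger centre \<open>3 * (R2 * U) + 3\<close> plus the error
    \<open>R2 * U\<close>.\<close>
  define D where "D = 4 * (R2 * U) + 3"
  define C where "C = D + U + R1 * D + (R1 * D * U + 1)"
  have "\<exists>z\<in>L1. \<exists>w\<in>L2. w \<noteq> 0 \<and> (\<forall>j r s.
      \<bar>(T_mat (z $ j) ** (V_mat (y $ j) ** (T_mat (x $ j) ** V_mat (w $ j)))) $ r $ s\<bar> \<le> C)"
    if u0: "\<And>j. 1 + x $ j * y $ j \<noteq> 0 \<and> \<bar>1 + x $ j * y $ j\<bar> \<le> U" for x y :: "real^'n"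
  proof -
    define u where "u = (\<lambda>j. 1 + x $ j * y $ j)"
    have u: "u j \<noteq> 0" "\<bar>u j\<bar> \<le> U" for j using u0[of j] by (auto simp: u_def)
    have U: "U \<ge> 0" using u(2)[of undefined] by linarith
    have RU: "R2 * U \<ge> 0" using R2(1) U by simp
    define j0 :: 'n where "j0 = undefined"
    \<comment> \<open>Two candidates for the centre of the target box for \<open>c\<close>: one of them forces \<open>w \<noteq> 0\<close>.\<close>
    obtain b where b: "b = R2 * U + 1 \<or> b = 3 * (R2 * U) + 3" "\<bar>b - y $ j0\<bar> > R2 * U"
    proof (cases "\<bar>R2 * U + 1 - y $ j0\<bar> > R2 * U")
      case False
      then have "\<bar>3 * (R2 * U) + 3 - y $ j0\<bar> > R2 * U" using RU by linarith
      then show ?thesis using that by blast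
    qed (use that in blast)
    \<comment> \<open>The real solution of \<open>c j = b\<close>, moved to a lattice point; the
      error in \<open>c j\<close> is at most \<open>R2 * U\<close>.\<close>
    obtain w where w: "w \<in> L2" "\<And>j. \<bar>w $ j - (b - y $ j) / u j\<bar> \<le> R2"
      using R2(2)[of "\<chi> j. (b - y $ j) / u j"] by auto
    define c where "c = (\<lambda>j. y $ j + u j * w $ j)"
    have cb: "\<bar>c j - b\<bar> \<le> R2 * U" for j
    proof -
      have "c j - b = u j * (w $ j - (b - y $ j) / u j)"
        using u(1)[of j] by (simp add: c_def field_simps)
      then show ?thesis
        using mult_mono[OF u(2)[of j] w(2)[of j]] U by (simp add: abs_mult mult.commute)
    qed
    have c: "1 \<le> c j" "c j \<le> D" for j
      using cb[of j] b(1) RU by (auto simp: D_def)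
    have D: "D \<ge> 1" using c[of undefined] by linarith
    \<comment> \<open>For \<open>w = 0\<close> the entry \<open>c j0\<close> would be
      \<open>y $ j0\<close>, which is too far from \<open>b\<close>.\<close>
    have "w \<noteq> 0" using cb[of j0] b(2) by (auto simp: c_def)
    \<comment> \<open>The real zero of the upper left entry, moved to a lattice point; the error is
      multiplied by \<open>c j\<close>, which is at most \<open>D\<close>.\<close>
    obtain z where z: "z \<in> L1" "\<And>j. \<bar>z $ j - (- (1 + x $ j * w $ j) / c j)\<bar> \<le> R1"
      using R1(2)[of "\<chi> j. - (1 + x $ j * w $ j) / c j"] by auto
    define a where "a = (\<lambda>j. 1 + x $ j * w $ j + z $ j * c j)"
    define d where "d = (\<lambda>j. x $ j + z $ j * u j)"
    have a: "\<bar>a j\<bar> \<le> R1 * D" for j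
    proof -
      have "a j = (z $ j - (- (1 + x $ j * w $ j) / c j)) * c j"
        using c(1)[of j] by (simp add: a_def field_simps)
      then show ?thesis
        using mult_mono[OF z(2)[of j] c(2)[of j]] R1(1) c(1)[of j] by (simp add: abs_mult)
    qed
    have d: "\<bar>d j\<bar> \<le> R1 * D * U + 1" for j
    proof -
      \<comment> \<open>This is the determinant condition; as \<open>c j\<close> is at least 1, it
        bounds \<open>d j\<close>.\<close>
      have "d j * c j = a j * u j - 1"
        by (simp add: d_def a_def c_def u_def algebra_simps)
      moreover have "\<bar>a j * u j\<bar> \<le> R1 * D * U"
        unfolding abs_mult using a u(2) R1(1) D by (intro mult_mono) auto
      moreover have "\<bar>d j\<bar> * 1 \<le> \<bar>d j\<bar> * c j" using c(1)[of j] by (intro mult_left_mono) auto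
      moreover have "\<bar>d j\<bar> * c j = \<bar>d j * c j\<bar>" using c(1)[of j] by (simp add: abs_mult)
      ultimately show ?thesis by linarith
    qed
    have "R1 * D \<ge> 0" "R1 * D * U \<ge> 0" using R1(1) D U by auto
    then have "\<bar>a j\<bar> \<le> C" "\<bar>d j\<bar> \<le> C" "\<bar>c j\<bar> \<le> C" "\<bar>u j\<bar> \<le> C" for j
      using a[of j] d[of j] c[of j] u(2)[of j] U D unfolding C_def by linarith+
    then have "\<bar>(vector [vector [a j, d j], vector [c j, u j]] :: real^2^2) $ r $ s\<bar> \<le> C" for j r s
      using exhaust_2[of r] exhaust_2[of s] by auto
    then show ?thesis
      using z(1) w(1) \<open>w \<noteq> 0\<close>
      by (intro bexI[of _ z] bexI[of _ w]) (auto simp: T_mat_V_mat_word a_def c_def d_def u_def)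
  qed
  then show ?thesis by (rule that)
qed

text \<open>A class determines its matrix up to sign, and the diagonal entries 1 fix the
  sign.\<close>

lemma T_elt_eq_iff: "T_elt x = T_elt x' \<longleftrightarrow> x = x'"
proof
  assume eq: "T_elt x = T_elt x'"
  show "x = x'"
  proof (rule vec_eq_iff[THEN iffD2], rule allI)
    fix j
    have "{T_mat (x $ j), - T_mat (x $ j)} = {T_mat (x' $ j), - T_mat (x' $ j)}"
      using fun_cong[OF eq, of j] by (simp add: T_elt_def PSL2_proj_eq)
    then have "T_mat (x $ j) = T_mat (x' $ j) \<or> T_mat (x $ j) = - T_mat (x' $ j)" by blast
    then show "x $ j = x' $ j" by (auto simp: T_mat_def vec_eq_iff forall_2)
  qed
qed simp

lemma V_elt_eq_iff: "V_elt x = V_elt x' \<longleftrightarrow> x = x'"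
proof
  assume eq: "V_elt x = V_elt x'"
  show "x = x'"
  proof (rule vec_eq_iff[THEN iffD2], rule allI)
    fix j
    have "{V_mat (x $ j), - V_mat (x $ j)} = {V_mat (x' $ j), - V_mat (x' $ j)}"
      using fun_cong[OF eq, of j] by (simp add: V_elt_def PSL2_proj_eq)
    then have "V_mat (x $ j) = V_mat (x' $ j) \<or> V_mat (x $ j) = - V_mat (x' $ j)" by blast
    then show "x $ j = x' $ j" by (auto simp: V_mat_def vec_eq_iff forall_2)
  qed
qed simp

lemma T_elt_eq_one_iff: "T_elt x = \<one>\<^bsub>PSL2n\<^esub> \<longleftrightarrow> x = 0"
  and V_elt_eq_one_iff: "V_elt x = \<one>\<^bsub>PSL2n\<^esub> \<longleftrightarrow> x = 0"
  using T_elt_eq_iff[of x 0] V_elt_eq_iff[of x 0] by (simp_all add: T_elt_zero V_elt_zero)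

section \<open>Coincidences among reduced words in a discrete group\<close>

theorem proposition4p3:
  fixes L1 L2 :: "(real^'n::finite) set"
  assumes "CARD('n) \<ge> 2"
    and "is_lattice L1" and "is_lattice L2"
    and "is_discrete_in_PSL2n (Gamma_grp L1 L2)"
  shows "Gamma_canonical L1 L2 \<notin>
    iso (free_product (PSL2n\<lparr>carrier := Gamma_upp L1\<rparr>) (PSL2n\<lparr>carrier := Gamma_low L2\<rparr>))
        (PSL2n\<lparr>carrier := Gamma_grp L1 L2\<rparr>)"
proof
  let ?A = "PSL2n\<lparr>carrier := Gamma_upp L1\<rparr>" and ?B = "PSL2n\<lparr>carrier := Gamma_low L2\<rparr>"
    and ?H = "PSL2n\<lparr>carrier := Gamma_grp L1 L2\<rparr>"
  assume iso: "Gamma_canonical L1 L2 \<in> iso (free_product ?A ?B) ?H"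
  interpret two_groups ?A ?B
    unfolding two_groups_def
    using group.subgroup_imp_group[OF group_PSL2n subgroup_Gamma_upp[OF assms(2)]]
      group.subgroup_imp_group[OF group_PSL2n subgroup_Gamma_low[OF assms(3)]] by simp
  have H: "group ?H"
    by (rule group.subgroup_imp_group[OF group_PSL2n subgroup_Gamma_grp])
  have "Gamma_upp L1 \<subseteq> Gamma_grp L1 L2" "Gamma_low L2 \<subseteq> Gamma_grp L1 L2"
    unfolding Gamma_grp_def by (blast intro: generate.incl)+
  then have id: "id \<in> hom ?A ?H" "id \<in> hom ?B ?H" by (auto intro!: homI)
  \<comment> \<open>Injectivity of the canonical map turns equal values in the group into equal
    normal forms.\<close>
  have inj: "fp_normal_form ?A ?B u = fp_normal_form ?A ?B v"
    if uv: "u \<in> fp_words ?A ?B" "v \<in> fp_words ?A ?B" and eq: "fp_eval ?H id id u = fp_eval ?H id id v"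
    for u v
  proof -
    have "inj_on (Gamma_canonical L1 L2) (carrier (free_product ?A ?B))"
      using iso by (auto simp: iso_def bij_betw_def)
    moreover have "Gamma_canonical L1 L2 (fp_rel ?A ?B `` {u}) =
        Gamma_canonical L1 L2 (fp_rel ?A ?B `` {v})"
      unfolding Gamma_canonical_def using eq
      by (simp add: free_product_lift_class[OF H id] uv)
    ultimately have "fp_rel ?A ?B `` {u} = fp_rel ?A ?B `` {v}"
      using uv by (auto dest: inj_onD)
    then show ?thesis using uv fp_class_eq_iff fp_normal_form_cong by blast
  qed
  have words: "T_elt x \<in> Gamma_upp L1 \<longleftrightarrow> x \<in> L1" "V_elt y \<in> Gamma_low L2 \<longleftrightarrow> y \<in> L2" for x y
    by (auto simp: Gamma_upp_def Gamma_low_def T_elt_eq_iff V_elt_eq_iff)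
  note nf_simps = fp_normal_form_def T_elt_eq_one_iff V_elt_eq_one_iff

  have supp: "\<exists>j. x $ j * y $ j \<noteq> 0" if xy: "x \<in> L1" "y \<in> L2" "x \<noteq> 0" "y \<noteq> 0" for x y
  proof (rule ccontr)
    assume "\<not> ?thesis"
    \<comment> \<open>The two products have the diagonal entries \<open>1 + x y\<close> and
      \<open>1\<close> in opposite order, so they agree when \<open>x y = 0\<close>.\<close>
    then have "T_mat (x $ j) ** V_mat (y $ j) = V_mat (y $ j) ** T_mat (x $ j)" for j
      by (simp add: T_mat_def V_mat_def matrix_matrix_mult_def vec_eq_iff forall_2 sum_2 mult.commute)
    then have "T_elt x \<otimes>\<^bsub>PSL2n\<^esub> V_elt y = V_elt y \<otimes>\<^bsub>PSL2n\<^esub> T_elt x"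
      using T_mat_SL2 V_mat_SL2 unfolding T_elt_def V_elt_def
      by (subst (1 2) PSL2n_mult_proj) (simp_all add: SL2_def)
    then have "fp_eval ?H id id [Inl (T_elt x), Inr (V_elt y)] =
        fp_eval ?H id id [Inr (V_elt y), Inl (T_elt x)]"
      using monoid.r_one[OF group.is_monoid[OF group_PSL2n] T_elt_carrier[of x]]
        monoid.r_one[OF group.is_monoid[OF group_PSL2n] V_elt_carrier[of y]]
      by (simp add: fp_eval_def)
    then have "fp_normal_form ?A ?B [Inl (T_elt x), Inr (V_elt y)] =
        fp_normal_form ?A ?B [Inr (V_elt y), Inl (T_elt x)]"
      using xy by (intro inj) (simp_all add: words)
    \<comment> \<open>Both words are already reduced, and they begin in different factors.\<close>
    then show False using xy by (simp add: nf_simps)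
  qed

  obtain U where U: "infinite {(x, y). x \<in> L1 \<and> y \<in> L2 \<and> x \<noteq> 0 \<and> y \<noteq> 0 \<and>
      (\<forall>j. 1 + x $ j * y $ j \<noteq> 0 \<and> \<bar>1 + x $ j * y $ j\<bar> \<le> U)}" (is "infinite ?I")
    using infinite_bounded_pairs[OF assms(1-3) supp] by blast
  \<comment> \<open>The first argument holds the outer letters \<open>z\<close> and
    \<open>w\<close>, the second the pair \<open>(x, y)\<close> that they complete.\<close>
  define word_mat where "word_mat = (\<lambda>(z, w) (x, y) j :: 'n.
    T_mat (z $ j) ** (V_mat (y $ j) ** (T_mat (x $ j) ** V_mat (w $ j))))"
  obtain C where C: "\<And>x y. (\<And>j. 1 + x $ j * y $ j \<noteq> 0 \<and> \<bar>1 + x $ j * y $ j\<bar> \<le> U) \<Longrightarrow>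
    \<exists>z\<in>L1. \<exists>w\<in>L2. w \<noteq> 0 \<and> (\<forall>j r s.
      \<bar>(T_mat (z $ j) ** (V_mat (y $ j) ** (T_mat (x $ j) ** V_mat (w $ j)))) $ r $ s\<bar> \<le> C)"
    using bounded_word[OF assms(2,3)] by blast
  have "\<forall>p\<in>?I. \<exists>q. fst q \<in> L1 \<and> snd q \<in> L2 \<and> snd q \<noteq> 0 \<and> (\<forall>j r s. \<bar>word_mat q p j $ r $ s\<bar> \<le> C)"
  proof
    fix p assume p: "p \<in> ?I"
    obtain x y where xy: "p = (x, y)" by force
    then obtain z w where "z \<in> L1" "w \<in> L2" "w \<noteq> 0"
        "\<And>j r s. \<bar>(T_mat (z $ j) ** (V_mat (y $ j) ** (T_mat (x $ j) ** V_mat (w $ j)))) $ r $ s\<bar> \<le> C"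
      using C[of x y] p by auto
    then show "\<exists>q. fst q \<in> L1 \<and> snd q \<in> L2 \<and> snd q \<noteq> 0 \<and> (\<forall>j r s. \<bar>word_mat q p j $ r $ s\<bar> \<le> C)"
      unfolding xy by (intro exI[of _ "(z, w)"]) (simp add: word_mat_def)
  qed
  from bchoice[OF this] obtain q where "\<forall>p\<in>?I. fst (q p) \<in> L1 \<and> snd (q p) \<in> L2 \<and>
      snd (q p) \<noteq> 0 \<and> (\<forall>j r s. \<bar>word_mat (q p) p j $ r $ s\<bar> \<le> C)" ..
  then have q: "\<And>p. p \<in> ?I \<Longrightarrow> fst (q p) \<in> L1 \<and> snd (q p) \<in> L2 \<and> snd (q p) \<noteq> 0"
      "\<And>p j r s. p \<in> ?I \<Longrightarrow> \<bar>word_mat (q p) p j $ r $ s\<bar> \<le> C"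
    by blast+

  define word where "word = (\<lambda>p. [Inl (T_elt (fst (q p))), Inr (V_elt (snd p)),
    Inl (T_elt (fst p)), Inr (V_elt (snd (q p)))])"
  have word: "word p \<in> fp_words ?A ?B" if "p \<in> ?I" for p
    using that q(1)[OF that] by (auto simp: word_def words)
  have det: "det (T_mat t) = 1" "det (V_mat t) = 1" for t
    using T_mat_SL2[of t] V_mat_SL2[of t] by (simp_all add: SL2_def)
  have eval: "fp_eval ?H id id (word p) = (\<lambda>j. PSL2_proj (word_mat (q p) p j))" for p
    by (simp add: word_def fp_eval_def T_elt_def V_elt_def PSL2n_one_proj PSL2n_mult_proj det det_mul
        word_mat_def split_beta)
  have "(\<lambda>p. fp_eval ?H id id (word p)) ` ?I \<subseteq>
      {g \<in> Gamma_grp L1 L2. \<exists>M. g = (\<lambda>j. PSL2_proj (M j)) \<and>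
        (\<forall>j. det (M j) = 1) \<and> (\<forall>j r s. \<bar>M j $ r $ s\<bar> \<le> C)}"
  proof (rule image_subsetI, rule CollectI, rule conjI)
    fix p assume p: "p \<in> ?I"
    show "fp_eval ?H id id (word p) \<in> Gamma_grp L1 L2"
      using fp_eval_closed[OF H id word[OF p]] by simp
    show "\<exists>M. fp_eval ?H id id (word p) = (\<lambda>j. PSL2_proj (M j)) \<and>
        (\<forall>j. det (M j) = 1) \<and> (\<forall>j r s. \<bar>M j $ r $ s\<bar> \<le> C)"
      by (intro exI[of _ "word_mat (q p) p"])
         (use q(2)[OF p] in \<open>auto simp: eval word_mat_def split_beta det_mul det\<close>)
  qed
  then have "finite ((\<lambda>p. fp_eval ?H id id (word p)) ` ?I)"
    using discrete_finite_bounded[OF assms(4) subgroup_Gamma_grp] finite_subset by blast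
  moreover have "inj_on (\<lambda>p. fp_eval ?H id id (word p)) ?I"
  proof (rule inj_onI)
    fix p p' assume p: "p \<in> ?I" "p' \<in> ?I"
      and "fp_eval ?H id id (word p) = fp_eval ?H id id (word p')"
    then have eq: "fp_normal_form ?A ?B (word p) = fp_normal_form ?A ?B (word p')"
      by (intro inj word)
    \<comment> \<open>The letter \<open>z\<close> may be zero, in which case it drops out. The other
      three letters are nontrivial and survive, so the normal form still determines \<open>x\<close>
      and \<open>y\<close>.\<close>
    have nf: "fp_normal_form ?A ?B (word p) =
        (if fst (q p) = 0 then [] else [Inl (T_elt (fst (q p)))]) @ tl (word p)" if "p \<in> ?I" for p
      using that q(1)[OF that] by (auto simp: nf_simps word_def)
    show "p = p'"
      using eq unfolding nf[OF p(1)] nf[OF p(2)]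
      by (auto simp: word_def T_elt_eq_iff V_elt_eq_iff prod_eq_iff split: if_splits)
  qed
  ultimately show False using U finite_imageD by blast
qed

end
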